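(* Let $k\ge 1$, let $D\subset\mathbb{R}^n$ be open, let $T>0$, $\varepsilon_0>0$, and let $F_i:\mathbb{R}\times D\to\mathbb{R}^n$ ($i=1,\ldots,k$) and $R:\mathbb{R}\times D\times[-\varepsilon_0,\varepsilon_0]\to\mathbb{R}^n$ be smooth functions that are $T$-periodic in the variable $t$. Consider the differential equation $$x'=\sum_{i=1}^k\varepsilon^iF_i(t,x)+\varepsilon^{k+1}R(t,x,\varepsilon),$$ and let $\mathbf{f}_1,\ldots,\mathbf{f}_k:D\to\mathbb{R}^n$ be its Melnikov functions (defined in the context). Denote $\mathbf{f}_0=0$ and let $\ell\in\{1,\ldots,k\}$ satisfy $\mathbf{f}_0=\mathbf{f}_1=\cdots=\mathbf{f}_{\ell-1}=0$ (identically on $D$). Then there exists a smooth near-identity transformation $x=U(t,\xi,\varepsilon)$, $T$-periodic in $t$, satisfying $U(0,\xi,\varepsilon)=\xi$, such that the differential equation is transformed into $$\xi'=\varepsilon^{\ell}\,\frac1T\,\mathbf{f}_\ell(\xi)+\varepsilon^{\ell+1}r_\ell(t,\xi,\varepsilon).$$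
   Context: Partial Bell polynomials: for positive integers $p\ge q$, $$B_{p,q}(x_1,\ldots,x_{p-q+1})=\sum\frac{p!}{b_1!\,b_2!\cdots b_{p-q+1}!}\prod_{j=1}^{p-q+1}\left(\frac{x_j}{j!}\right)^{b_j},$$ where the sum is over all tuples of nonnegative integers $(b_1,\ldots,b_{p-q+1})$ with $b_1+2b_2+\cdots+(p-q+1)b_{p-q+1}=p$ and $b_1+\cdots+b_{p-q+1}=q$. $\partial_x^mF(s,z)$ denotes the $m$-th Fréchet derivative of $F$ in the space variable at $z$, a symmetric $m$-multilinear map. An expression $\partial_x^mF(s,z)\,B_{j,m}(v_1,\ldots,v_{j-m+1})$ with $v_l\in\mathbb{R}^n$ means: each monomial of $B_{j,m}$ is a formal (symmetric) product of $m$ vectors, and the multilinear map is applied to those $m$ vectors, extended linearly. Melnikov functions: define $y_1(t,z)=\int_0^tF_1(s,z)\,ds$ and, for $i\in\{2,\ldots,k\}$, $$y_i(t,z)=\int_0^t\bigg(i!\,F_i(s,z)+\sum_{j=1}^{i-1}\sum_{m=1}^j\frac{i!}{j!}\,\partial_x^mF_{i-j}(s,z)\,B_{j,m}\big(y_1,\ldots,y_{j-m+1}\big)(s,z)\bigg)ds.$$ Then $\mathbf{f}_i(z)=y_i(T,z)/i!$ for $i\in\{1,\ldots,k\}$. (It is a known fact that the solution $x(t,z,\varepsilon)$ with $x(0,z,\varepsilon)=z$ satisfies $x(t,z,\varepsilon)=z+\sum_{i=1}^k\varepsilon^iy_i(t,z)/i!+\mathcal{O}(\varepsilon^{k+1})$.)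 Near-identity transformations: a smooth $T$-periodic near-identity transformation is a map of the form $U(t,\xi,\varepsilon)=\xi+\sum_{i=1}^k\varepsilon^i\mathbf{u}_i(t,\xi)$ with $\mathbf{u}_i:\mathbb{R}\times D\to\mathbb{R}^n$ smooth and $T$-periodic in $t$. It transforms the differential equation $x'=X(t,x,\varepsilon)$ into $\xi'=Y(t,\xi,\varepsilon)$ if $$\partial_tU(t,\xi,\varepsilon)+\partial_\xi U(t,\xi,\varepsilon)\,Y(t,\xi,\varepsilon)=X(t,U(t,\xi,\varepsilon),\varepsilon),$$ where, as usual, this is required locally: for each open $V$ with compact closure contained in $D$, there is $\varepsilon_V\in(0,\varepsilon_0]$ such that for $\xi\in V$ and $|\varepsilon|\le\varepsilon_V$ one has $U(t,\xi,\varepsilon)\in D$ for all $t$, the remainder $r_\ell$ is defined, smooth and $T$-periodic in $t$, and the identity holds. *)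

theory Defs
  imports "HOL-Analysis.Analysis"
begin

text \<open>
  Smoothness on a set that need not be open: the sets used below are products of an open set with
  \<open>UNIV\<close> and possibly a nondegenerate compact interval of parameters. On such a set the derivative
  within the set is unique (and one-sided in the parameter at the ends of the interval), so the
  existential quantifier only names it. Continuity of all directional derivatives \<open>\<lambda>x. f' x v\<close>
  amounts to continuity of \<open>f'\<close>, because the domain is finite-dimensional.
\<close>

primrec Ck_on :: "nat \<Rightarrow> 'a::euclidean_space set \<Rightarrow> ('a \<Rightarrow> 'b::real_normed_vector) \<Rightarrow> bool" where
  "Ck_on 0 S f \<longleftrightarrow> continuous_on S f"
| "Ck_on (Suc m) S f \<longleftrightarrow>
     (\<exists>f'. (\<forall>x\<in>S. (f has_derivative f' x) (at x within S)) \<and> (\<forall>v. Ck_on m S (\<lambda>x. f' x v)))"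

definition smooth_on :: "'a::euclidean_space set \<Rightarrow> ('a \<Rightarrow> 'b::real_normed_vector) \<Rightarrow> bool" where
  "smooth_on S f \<longleftrightarrow> (\<forall>m. Ck_on m S f)"

text \<open>
  \<open>frechet_iter f [v\<^sub>1, \<dots>, v\<^sub>m] z\<close> is the value at \<open>(v\<^sub>1, \<dots>, v\<^sub>m)\<close> of the \<open>m\<close>-th Frechet derivative
  of \<open>f\<close> at \<open>z\<close>, i.e. \<open>D\<^sup>mf(z)(v\<^sub>1,\<dots>,v\<^sub>m) = D(x \<mapsto> D\<^sup>m\<^sup>-\<^sup>1f(x)(v\<^sub>2,\<dots>,v\<^sub>m))(z) v\<^sub>1\<close>.
\<close>

primrec frechet_iter ::
  "('a::real_normed_vector \<Rightarrow> 'b::real_normed_vector) \<Rightarrow> 'a list \<Rightarrow> 'a \<Rightarrow> 'b" where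
  "frechet_iter f [] z = f z"
| "frechet_iter f (v # vs) z = frechet_derivative (frechet_iter f vs) (at z) v"

text \<open>
  The monomials of the partial Bell polynomial \<open>B\<^sub>p\<^sub>,\<^sub>q\<close> are indexed by their exponents
  \<open>b 1, \<dots>, b (p - q + 1)\<close>; the other values of \<open>b\<close> are fixed to be \<open>0\<close>.
\<close>

definition bell_exponents :: "nat \<Rightarrow> nat \<Rightarrow> (nat \<Rightarrow> nat) set" where
  "bell_exponents p q = {b. (\<forall>l. l \<notin> {1..p - q + 1} \<longrightarrow> b l = 0) \<and>
     (\<Sum>l = 1..p - q + 1. l * b l) = p \<and> (\<Sum>l = 1..p - q + 1. b l) = q}"

definition bell_coeff :: "nat \<Rightarrow> nat \<Rightarrow> (nat \<Rightarrow> nat) \<Rightarrow> real" where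
  "bell_coeff p q b =
     fact p / (\<Prod>l = 1..p - q + 1. fact (b l)) * (\<Prod>l = 1..p - q + 1. (1 / fact l) ^ b l)"

lemma finite_bell_exponents: "finite (bell_exponents p q)"
proof (rule finite_subset)
  have "b l \<le> q" if "(\<Sum>l = 1..p - q + 1. b l) = q" "l \<in> {1..p - q + 1}" for b l
    using member_le_sum[of l "{1..p - q + 1}" b] that by simp
  then show "bell_exponents p q \<subseteq> {b. \<forall>l. (l \<in> {1..p - q + 1} \<longrightarrow> b l \<in> {..q}) \<and>
      (l \<notin> {1..p - q + 1} \<longrightarrow> b l = 0)}"
    by (auto simp: bell_exponents_def)
qed (rule finite_set_of_finite_funs; simp)

text \<open>
  \<open>bell_apply f z p q v\<close> is \<open>D\<^sup>qf(z) B\<^sub>p\<^sub>,\<^sub>q(v\<^sub>1, \<dots>, v\<^sub>p\<^sub>-\<^sub>q\<^sub>+\<^sub>1)\<close>: the monomial with exponents \<open>b\<close> stands for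
  the list of \<open>q\<close> vectors in which each \<open>v l\<close> is repeated \<open>b l\<close> times.
\<close>

definition bell_apply ::
  "('a::real_normed_vector \<Rightarrow> 'b::real_normed_vector) \<Rightarrow> 'a \<Rightarrow> nat \<Rightarrow> nat \<Rightarrow> (nat \<Rightarrow> 'a) \<Rightarrow> 'b" where
  "bell_apply f z p q v = (\<Sum>b\<in>bell_exponents p q. bell_coeff p q b *\<^sub>R
     frechet_iter f (concat (map (\<lambda>l. replicate (b l) (v l)) [1..<p - q + 2])) z)"

lemma bell_apply_cong [fundef_cong]:
  assumes "f = f'" "z = z'" "p = p'" "q = q'"
    and "\<And>l. 1 \<le> l \<Longrightarrow> l \<le> p' - q' + 1 \<Longrightarrow> v l = v' l"
  shows "bell_apply f z p q v = bell_apply f' z' p' q' v'"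
proof -
  have "map (\<lambda>l. replicate (b l) (v l)) [1..<p' - q' + 2] =
        map (\<lambda>l. replicate (b l) (v' l)) [1..<p' - q' + 2]" for b :: "nat \<Rightarrow> nat"
    by (rule map_cong) (auto intro!: assms(5))
  then show ?thesis
    by (simp only: bell_apply_def assms(1-4))
qed

text \<open>
  The interval integral is oriented, so \<open>t\<close> may be negative. Only the indices \<open>i \<ge> 1\<close> are meaningful.
\<close>

function melnikov_y ::
  "(nat \<Rightarrow> real \<Rightarrow> (real ^ 'n) \<Rightarrow> real ^ 'n) \<Rightarrow> nat \<Rightarrow> real \<Rightarrow> real ^ 'n \<Rightarrow> real ^ 'n" where
  "melnikov_y F i t z = (LBINT s = 0..ereal t.
     fact i *\<^sub>R F i s z +
     (\<Sum>j = 1..i - 1. \<Sum>m = 1..j. (fact i / fact j) *\<^sub>R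
        bell_apply (F (i - j) s) z j m (\<lambda>l. melnikov_y F l s z)))"
  by pat_completeness auto
termination
  by (relation "Wellfounded.measure (\<lambda>(F, i, t, z). i)") auto

declare melnikov_y.simps [simp del]

definition melnikov ::
  "(nat \<Rightarrow> real \<Rightarrow> (real ^ 'n) \<Rightarrow> real ^ 'n) \<Rightarrow> real \<Rightarrow> nat \<Rightarrow> real ^ 'n \<Rightarrow> real ^ 'n" where
  "melnikov F T i z = (if i = 0 then 0 else (1 / fact i) *\<^sub>R melnikov_y F i T z)"

definition near_identity ::
  "nat \<Rightarrow> (nat \<Rightarrow> real \<Rightarrow> (real ^ 'n) \<Rightarrow> real ^ 'n) \<Rightarrow> real \<Rightarrow> real ^ 'n \<Rightarrow> real \<Rightarrow> real ^ 'n" where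
  "near_identity k u t \<xi> \<epsilon> = \<xi> + (\<Sum>i = 1..k. \<epsilon> ^ i *\<^sub>R u i t \<xi>)"

definition transforms_at ::
  "(real \<Rightarrow> (real ^ 'n) \<Rightarrow> real \<Rightarrow> real ^ 'n) \<Rightarrow> (real \<Rightarrow> (real ^ 'n) \<Rightarrow> real \<Rightarrow> real ^ 'n) \<Rightarrow>
   (real \<Rightarrow> (real ^ 'n) \<Rightarrow> real \<Rightarrow> real ^ 'n) \<Rightarrow> real \<Rightarrow> real ^ 'n \<Rightarrow> real \<Rightarrow> bool" where
  "transforms_at U X Y t \<xi> \<epsilon> \<longleftrightarrow>
     vector_derivative (\<lambda>s. U s \<xi> \<epsilon>) (at t) +
     frechet_derivative (\<lambda>x. U t x \<epsilon>) (at \<xi>) (Y t \<xi> \<epsilon>) = X t (U t \<xi> \<epsilon>) \<epsilon>"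

end

theory Submission
  imports Defs
begin

text \<open>
  The transformation is the truncated flow, made periodic. Write \<open>y\<^sub>i = melnikov_y F i\<close> and
  \<open>f\<^sub>l = melnikov F T l\<close>. The functions \<open>y\<^sub>i\<close> are built so that, formally,
  \<open>x(t) = z + \<Sum> \<epsilon>\<^sup>i y\<^sub>i(t,z) / i!\<close> solves the equation; comparing coefficients of \<open>\<epsilon>\<^sup>n\<close>, this says that
  \<open>\<partial>\<^sub>t y\<^sub>n / n!\<close> is the coefficient of \<open>\<epsilon>\<^sup>n\<close> in \<open>\<Sum> \<epsilon>\<^sup>i F\<^sub>i(t, z + \<Sum> \<epsilon>\<^sup>m y\<^sub>m / m!)\<close>, and that coefficient
  only involves \<open>y\<^sub>m\<close> with \<open>m < n\<close>. Since \<open>y\<^sub>n\<close> is the primitive of a function of \<open>y\<^sub>1, \<dots>, y\<^bsub>n-1\<^esub>\<close> and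
  of the \<open>T\<close>-periodic fields, an induction shows that \<open>y\<^sub>n\<close> is \<open>T\<close>-periodic as long as all \<open>f\<^sub>i\<close> with
  \<open>i \<le> n\<close> vanish, and that \<open>y\<^sub>l(t + T) = y\<^sub>l(t) + l! f\<^sub>l\<close>. Hence
  \<open>u\<^sub>i = y\<^sub>i / i!\<close> for \<open>i < l\<close>, \<open>u\<^sub>l = y\<^sub>l / l! - (t / T) f\<^sub>l\<close>, and \<open>u\<^sub>i = 0\<close> for \<open>i > l\<close> are \<open>T\<close>-periodic and
  vanish at \<open>t = 0\<close>, and \<open>X(t, U, \<epsilon>) - \<partial>\<^sub>t U = \<epsilon>\<^sup>l f\<^sub>l / T\<close> up to terms of order \<open>l + 1\<close> in \<open>\<epsilon>\<close>. Because
  \<open>\<partial>\<^sub>\<xi> U\<close> is the identity at \<open>\<epsilon> = 0\<close>, solving \<open>\<partial>\<^sub>\<xi> U Y = X(t, U, \<epsilon>) - \<partial>\<^sub>t U\<close> for \<open>Y\<close> gives the claim.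

  Two points need work. The first is the identification of the Bell polynomial sums with Taylor
  coefficients (\<open>faa_di_bruno\<close>). It is proved in the form of an asymptotic expansion, by expanding
  \<open>f(z + \<Sum> \<epsilon>\<^sup>m v\<^sub>m / m!)\<close> in one direction \<open>v\<^sub>m\<close> after the other with the one-dimensional Taylor formula
  (\<open>multivariate_expansion\<close>); the iterated directional derivatives then appear in exactly the order
  in which \<open>bell_apply\<close> lists its vectors, so that the terms of the two sums agree one by one. The same identity, read from right to left, gives the joint smoothness of the
  Bell sums in \<open>(t, x)\<close> and hence that of all \<open>y\<^sub>n\<close> (\<open>smooth_on_expansion_coeff\<close>).

  The second is the smoothness of the remainder \<open>r\<^sub>l\<close>, including at \<open>\<epsilon> = 0\<close>. The integral form of
  Taylor's remainder shows that a smooth function which vanishes to order \<open>M\<close> in \<open>\<epsilon>\<close> at each fixed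
  \<open>(t, \<xi>)\<close> is \<open>\<epsilon>\<^sup>M\<close> times a smooth function (\<open>smooth_division\<close>), and Cramer's rule inverts \<open>\<partial>\<^sub>\<xi> U\<close>
  smoothly. Both are carried out once on an open set of \<open>(t, \<xi>, \<epsilon>)\<close> which contains
  \<open>\<real> \<times> V \<times> [-\<epsilon>\<^sub>V, \<epsilon>\<^sub>V]\<close> for each relatively compact \<open>V\<close> and a suitable \<open>\<epsilon>\<^sub>V\<close>, so that one function
  \<open>r\<^sub>l\<close> serves all \<open>V\<close> (\<open>near_identity_normal_form\<close>).
\<close>

section \<open>Calculus of \<open>C\<^sup>m\<close> and smooth functions\<close>

lemma Ck_on_SucI:
  assumes "\<And>x. x \<in> S \<Longrightarrow> (f has_derivative f' x) (at x within S)"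
    and "\<And>v. Ck_on m S (\<lambda>x. f' x v)"
  shows "Ck_on (Suc m) S f"
  using assms by auto

lemma Ck_on_SucE:
  assumes "Ck_on (Suc m) S f"
  obtains f' where "\<And>x. x \<in> S \<Longrightarrow> (f has_derivative f' x) (at x within S)"
    and "\<And>v. Ck_on m S (\<lambda>x. f' x v)"
  using assms by auto

lemma has_derivative_within_compose:
  assumes "(f has_derivative f') (at (g x) within S)" "(g has_derivative g') (at x within S')"
    and "g ` S' \<subseteq> S"
  shows "((\<lambda>x. f (g x)) has_derivative (\<lambda>v. f' (g' v))) (at x within S')"
  by (rule has_derivative_in_compose[OF assms(2) has_derivative_subset[OF assms(1,3)]])

lemma Ck_on_subset: "Ck_on m S f \<Longrightarrow> S' \<subseteq> S \<Longrightarrow> Ck_on m S' f"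
proof (induction m arbitrary: f)
  case 0
  then show ?case by (auto intro: continuous_on_subset)
next
  case (Suc m)
  from Suc.prems(1) obtain f' where "\<And>x. x \<in> S \<Longrightarrow> (f has_derivative f' x) (at x within S)"
    "\<And>v. Ck_on m S (\<lambda>x. f' x v)" by (rule Ck_on_SucE) blast
  with Suc.prems(2) Suc.IH show ?case
    by (intro Ck_on_SucI[of S' f f']) (blast intro: has_derivative_subset)+
qed

lemma Ck_on_cong:
  assumes eq: "\<And>x. x \<in> S \<Longrightarrow> f x = g x"
  shows "Ck_on m S f \<longleftrightarrow> Ck_on m S g"
proof (cases m)
  case (Suc n)
  have "(f has_derivative h) (at x within S) \<longleftrightarrow> (g has_derivative h) (at x within S)" if "x \<in> S" for h x
    using has_derivative_transform[OF that, of f g] has_derivative_transform[OF that, of g f] eq by auto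
  with Suc show ?thesis by simp
qed (simp add: eq cong: continuous_on_cong)

lemma Ck_on_imp_continuous_on: "Ck_on m S f \<Longrightarrow> continuous_on S f"
  by (cases m) (auto simp: continuous_on_eq_continuous_within intro: has_derivative_continuous)

lemma Ck_on_SucD: "Ck_on (Suc m) S f \<Longrightarrow> Ck_on m S f"
proof (induction m arbitrary: f)
  case 0
  then show ?case using Ck_on_imp_continuous_on[OF 0] by simp
next
  case (Suc m)
  from Suc.prems obtain f' where "\<And>x. x \<in> S \<Longrightarrow> (f has_derivative f' x) (at x within S)"
    "\<And>v. Ck_on (Suc m) S (\<lambda>x. f' x v)" by (rule Ck_on_SucE) blast
  with Suc.IH show ?case by (intro Ck_on_SucI[of S f f']) blast+
qed

lemma Ck_on_const: "Ck_on m S (\<lambda>x. c)"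
proof (induction m arbitrary: c)
  case (Suc m)
  then show ?case by (intro Ck_on_SucI[of _ _ "\<lambda>x v. 0"]) auto
qed simp

lemma Ck_on_id: "Ck_on m S (\<lambda>x. x)"
proof (cases m)
  case (Suc n)
  then show ?thesis
    by (simp only:) (rule Ck_on_SucI[of _ _ "\<lambda>x v. v"]; simp add: Ck_on_const)
qed (simp add: continuous_on_id)

lemma Ck_on_bounded_linear: "bounded_linear L \<Longrightarrow> Ck_on m S f \<Longrightarrow> Ck_on m S (\<lambda>x. L (f x))"
proof (induction m arbitrary: f)
  case 0
  then show ?case by (auto intro: bounded_linear.continuous_on)
next
  case (Suc m)
  from Suc.prems(2) obtain f' where "\<And>x. x \<in> S \<Longrightarrow> (f has_derivative f' x) (at x within S)"
    "\<And>v. Ck_on m S (\<lambda>x. f' x v)" by (rule Ck_on_SucE) blast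
  with Suc.prems(1) Suc.IH show ?case
    by (intro Ck_on_SucI[of _ _ "\<lambda>x v. L (f' x v)"]) (auto intro: bounded_linear.has_derivative)
qed

lemma Ck_on_add: "Ck_on m S f \<Longrightarrow> Ck_on m S g \<Longrightarrow> Ck_on m S (\<lambda>x. f x + g x)"
proof (induction m arbitrary: f g)
  case 0
  then show ?case by (auto intro: continuous_intros)
next
  case (Suc m)
  obtain f' where "\<And>x. x \<in> S \<Longrightarrow> (f has_derivative f' x) (at x within S)"
    "\<And>v. Ck_on m S (\<lambda>x. f' x v)" using Suc.prems(1) by (rule Ck_on_SucE) blast
  moreover obtain g' where "\<And>x. x \<in> S \<Longrightarrow> (g has_derivative g' x) (at x within S)"
    "\<And>v. Ck_on m S (\<lambda>x. g' x v)" using Suc.prems(2) by (rule Ck_on_SucE) blast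
  ultimately show ?case using Suc.IH
    by (intro Ck_on_SucI[of _ _ "\<lambda>x v. f' x v + g' x v"] has_derivative_add) auto
qed

lemma Ck_on_scaleR:
  "Ck_on m S a \<Longrightarrow> Ck_on m S f \<Longrightarrow> Ck_on m S (\<lambda>x. a x *\<^sub>R f x)"
proof (induction m arbitrary: a f)
  case 0
  then show ?case by (auto intro: continuous_intros)
next
  case (Suc m)
  obtain f' where f': "\<And>x. x \<in> S \<Longrightarrow> (f has_derivative f' x) (at x within S)"
    "\<And>v. Ck_on m S (\<lambda>x. f' x v)" using Suc.prems(2) by (rule Ck_on_SucE) blast
  obtain a' where a': "\<And>x. x \<in> S \<Longrightarrow> (a has_derivative a' x) (at x within S)"
    "\<And>v. Ck_on m S (\<lambda>x. a' x v)" using Suc.prems(1) by (rule Ck_on_SucE) blast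
  have "Ck_on m S a" "Ck_on m S f"
    using Suc.prems Ck_on_SucD by blast+
  then show ?case
    by (intro Ck_on_SucI[of _ _ "\<lambda>x v. a x *\<^sub>R f' x v + a' x v *\<^sub>R f x"] has_derivative_scaleR
        Ck_on_add Suc.IH f' a')
qed

lemma Ck_on_sum: "(\<And>i. i \<in> I \<Longrightarrow> Ck_on m S (f i)) \<Longrightarrow> Ck_on m S (\<lambda>x. \<Sum>i\<in>I. f i x)"
  by (induction I rule: infinite_finite_induct) (simp_all add: Ck_on_add Ck_on_const)

lemma Ck_on_compose:
  "Ck_on m S f \<Longrightarrow> Ck_on m S' g \<Longrightarrow> g ` S' \<subseteq> S \<Longrightarrow> Ck_on m S' (\<lambda>x. f (g x))"
proof (induction m arbitrary: f g)
  case 0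
  then show ?case by (auto intro: continuous_on_compose2)
next
  case (Suc m)
  obtain f' where f': "\<And>x. x \<in> S \<Longrightarrow> (f has_derivative f' x) (at x within S)"
    "\<And>v. Ck_on m S (\<lambda>x. f' x v)" using Suc.prems(1) by (rule Ck_on_SucE) blast
  obtain g' where g': "\<And>x. x \<in> S' \<Longrightarrow> (g has_derivative g' x) (at x within S')"
    "\<And>v. Ck_on m S' (\<lambda>x. g' x v)" using Suc.prems(2) by (rule Ck_on_SucE) blast
  have "Ck_on m S' g"
    using Suc.prems(2) by (rule Ck_on_SucD)
  \<comment> \<open>The chain rule is written in coordinates, so that only products of scalar functions with
    functions of the form \<open>f' \<circ> g\<close> occur, to which the induction hypothesis applies.\<close>
  then have *: "Ck_on m S' (\<lambda>x. \<Sum>b\<in>Basis. (g' x v \<bullet> b) *\<^sub>R f' (g x) b)" for v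
    by (intro Ck_on_sum Ck_on_scaleR Ck_on_bounded_linear[OF bounded_linear_inner_left] g'(2)
        Suc.IH[OF f'(2)] Suc.prems(3))
  have "(\<Sum>b\<in>Basis. (g' x v \<bullet> b) *\<^sub>R f' (g x) b) = f' (g x) (g' x v)" if "x \<in> S'" for x v
  proof -
    have "linear (f' (g x))"
      using f'(1)[of "g x"] Suc.prems(3) that by (auto dest: has_derivative_linear)
    then have "f' (g x) (\<Sum>b\<in>Basis. (g' x v \<bullet> b) *\<^sub>R b) = (\<Sum>b\<in>Basis. (g' x v \<bullet> b) *\<^sub>R f' (g x) b)"
      by (simp add: linear_sum linear_cmul)
    then show ?thesis by (simp add: euclidean_representation)
  qed
  then have "Ck_on m S' (\<lambda>x. f' (g x) (g' x v))" for v
    by (rule Ck_on_cong[THEN iffD1, OF _ *])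
  moreover have "((\<lambda>x. f (g x)) has_derivative (\<lambda>v. f' (g x) (g' x v))) (at x within S')" if "x \<in> S'" for x
    using that Suc.prems(3) by (auto intro: has_derivative_within_compose[OF f'(1) g'(1)])
  ultimately show ?case by (rule Ck_on_SucI[rotated])
qed

lemma Ck_on_inverse:
  fixes g :: "'a::euclidean_space \<Rightarrow> real"
  assumes "\<And>x. x \<in> S \<Longrightarrow> g x \<noteq> 0"
  shows "Ck_on m S g \<Longrightarrow> Ck_on m S (\<lambda>x. inverse (g x))"
proof (induction m)
  case 0
  then show ?case using assms by (auto intro: continuous_intros)
next
  case (Suc m)
  obtain g' where g': "\<And>x. x \<in> S \<Longrightarrow> (g has_derivative g' x) (at x within S)"
    "\<And>v. Ck_on m S (\<lambda>x. g' x v)" using Suc.prems by (rule Ck_on_SucE) blast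
  have "Ck_on m S (\<lambda>x. inverse (g x))"
    using Suc Ck_on_SucD by blast
  then have "Ck_on m S (\<lambda>x. (- 1) *\<^sub>R (inverse (g x) *\<^sub>R (g' x v *\<^sub>R inverse (g x))))" for v
    by (intro Ck_on_scaleR g' Ck_on_const)
  then have "Ck_on m S (\<lambda>x. - (inverse (g x) * g' x v * inverse (g x)))" for v
    by (simp only: real_scaleR_def mult_minus1 mult.assoc)
  then show ?case
    using assms g'(1)
    by (intro Ck_on_SucI[of _ _ "\<lambda>x v. - (inverse (g x) * g' x v * inverse (g x))"]
      Deriv.has_derivative_inverse) auto
qed

text \<open>
  Smooth dependence of an integral on parameters. Differentiating under the integral sign turns \<open>G\<close>
  into a partial derivative of \<open>G\<close>, which is of class one lower, so the statement follows by induction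
  on \<open>m\<close>. The set \<open>P \<times> {0..1}\<close> is not open; this is harmless, as only derivatives in the
  directions \<open>(v, 0)\<close> enter.
\<close>

lemma Ck_on_integral:
  fixes G :: "'a::euclidean_space \<times> real \<Rightarrow> 'b::euclidean_space"
  assumes "open P"
  shows "Ck_on m (P \<times> {0..1}) G \<Longrightarrow> Ck_on m P (\<lambda>p. integral {0..1} (\<lambda>s. G (p, s)))"
proof (induction m arbitrary: G)
  case 0
  then show ?case
    using integral_continuous_on_param[of P 0 1 "\<lambda>p s. G (p, s)"] by simp
next
  case (Suc m)
  obtain G' where G': "\<And>q. q \<in> P \<times> {0..1} \<Longrightarrow> (G has_derivative G' q) (at q within P \<times> {0..1})"
    "\<And>v. Ck_on m (P \<times> {0..1}) (\<lambda>q. G' q v)" using Suc.prems by (rule Ck_on_SucE) blast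
  define B where "B p s = Blinfun (\<lambda>v. G' (p, s) (v, 0))" for p s
  have B: "blinfun_apply (B p s) v = G' (p, s) (v, 0)" if "p \<in> P" "s \<in> {0..1}" for p s v
  proof -
    have "bounded_linear (G' (p, s))"
      using G'(1)[of "(p, s)"] that by (auto dest: has_derivative_bounded_linear)
    then have "bounded_linear (\<lambda>v. G' (p, s) (v, 0))"
      by (rule bounded_linear_compose) (auto intro!: bounded_linear_intros)
    then show ?thesis by (simp add: B_def bounded_linear_Blinfun_apply)
  qed
  have cont: "continuous_on (P \<times> {0..1}) (\<lambda>(p, s). B p s)"
  proof (rule continuous_on_blinfun_componentwise)
    fix i :: 'a
    have "continuous_on (P \<times> {0..1}) (\<lambda>q. G' q (i, 0))"
      using G'(2) Ck_on_imp_continuous_on by blast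
    then show "continuous_on (P \<times> {0..1}) (\<lambda>x. blinfun_apply (case x of (p, s) \<Rightarrow> B p s) i)"
      by (rule continuous_on_eq) (auto simp: B)
  qed
  have contG: "continuous_on (P \<times> {0..1}) G"
    using Suc.prems Ck_on_imp_continuous_on by blast
  have deriv: "((\<lambda>p. integral {0..1} (\<lambda>s. G (p, s))) has_derivative
      (\<lambda>v. integral {0..1} (\<lambda>s. G' (p, s) (v, 0)))) (at p within P)" if p: "p \<in> P" for p
  proof -
    obtain e where e: "e > 0" "ball p e \<subseteq> P"
      using \<open>open P\<close> p open_contains_ball by blast
    have d: "((\<lambda>x. G (x, t)) has_derivative blinfun_apply (B x t)) (at x within ball p e)"
      if "x \<in> ball p e" "t \<in> cbox 0 1" for x t
    proof -
      have xP: "x \<in> P" and t: "t \<in> {0..1}" using that e by auto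
      have pair: "((\<lambda>x. (x, t)) has_derivative (\<lambda>v. (v, 0))) (at x within P)"
        by (auto intro!: derivative_eq_intros)
      have "((\<lambda>x. G (x, t)) has_derivative (\<lambda>v. G' (x, t) (v, 0))) (at x within P)"
        by (rule has_derivative_within_compose[OF G'(1) pair]) (use xP t in auto)
      moreover have "(\<lambda>v. G' (x, t) (v, 0)) = blinfun_apply (B x t)"
        using B[OF xP t] by auto
      ultimately show ?thesis using e(2) has_derivative_subset by metis
    qed
    have int: "(\<lambda>s. G (x, s)) integrable_on cbox 0 1" if "x \<in> ball p e" for x
      using that e(2)
      by (intro integrable_continuous continuous_on_compose2[OF contG] continuous_intros) auto
    have "continuous_on (ball p e \<times> cbox 0 1) (\<lambda>(p, s). B p s)"
      using cont by (rule continuous_on_subset) (use e in auto)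
    from leibniz_rule[OF d int this] e
    have L: "((\<lambda>x. integral {0..1} (\<lambda>s. G (x, s))) has_derivative
        blinfun_apply (integral {0..1} (B p))) (at p within ball p e)"
      by simp
    have "B p integrable_on {0..1}"
      using continuous_on_compose2[OF cont, of "{0..1}" "\<lambda>s. (p, s)"] p
        continuous_on_Pair[of "{0..1}" "\<lambda>_. p" "\<lambda>s. s"]
      by (intro integrable_continuous_interval) auto
    then have "blinfun_apply (integral {0..1} (B p)) v = integral {0..1} (\<lambda>s. blinfun_apply (B p s) v)" for v
      by (rule blinfun_apply_integral)
    then have eq: "blinfun_apply (integral {0..1} (B p)) = (\<lambda>v. integral {0..1} (\<lambda>s. G' (p, s) (v, 0)))"
      by (auto simp: B[OF p] intro!: ext integral_cong)
    show ?thesis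
      using L[unfolded eq]
      using e p at_within_open[of p "ball p e"] by (auto intro: has_derivative_at_withinI)
  qed
  have "Ck_on m P (\<lambda>p. integral {0..1} (\<lambda>s. G' (p, s) (v, 0)))" for v
    by (rule Suc.IH) (rule G'(2))
  with deriv show ?case by (rule Ck_on_SucI)
qed

lemma smooth_on_subset: "smooth_on S f \<Longrightarrow> S' \<subseteq> S \<Longrightarrow> smooth_on S' f"
  unfolding smooth_on_def using Ck_on_subset by blast

lemma smooth_on_cong: "(\<And>x. x \<in> S \<Longrightarrow> f x = g x) \<Longrightarrow> smooth_on S f \<longleftrightarrow> smooth_on S g"
  unfolding smooth_on_def using Ck_on_cong[of S f g] by simp

lemma smooth_on_imp_continuous_on: "smooth_on S f \<Longrightarrow> continuous_on S f"
  unfolding smooth_on_def using Ck_on_imp_continuous_on by blast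

lemma smooth_on_const: "smooth_on S (\<lambda>x. c)"
  unfolding smooth_on_def by (simp add: Ck_on_const)

lemma smooth_on_id: "smooth_on S (\<lambda>x. x)"
  unfolding smooth_on_def by (simp add: Ck_on_id)

lemma smooth_on_bounded_linear:
  "bounded_linear L \<Longrightarrow> smooth_on S f \<Longrightarrow> smooth_on S (\<lambda>x. L (f x))"
  unfolding smooth_on_def by (simp add: Ck_on_bounded_linear)

lemma smooth_on_add: "smooth_on S f \<Longrightarrow> smooth_on S g \<Longrightarrow> smooth_on S (\<lambda>x. f x + g x)"
  unfolding smooth_on_def by (simp add: Ck_on_add)

lemma smooth_on_scaleR: "smooth_on S a \<Longrightarrow> smooth_on S f \<Longrightarrow> smooth_on S (\<lambda>x. a x *\<^sub>R f x)"
  unfolding smooth_on_def by (simp add: Ck_on_scaleR)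

lemma smooth_on_mult:
  fixes f g :: "_ \<Rightarrow> real"
  shows "smooth_on S f \<Longrightarrow> smooth_on S g \<Longrightarrow> smooth_on S (\<lambda>x. f x * g x)"
  using smooth_on_scaleR[of S f g] by simp

lemma smooth_on_sum:
  "(\<And>i. i \<in> I \<Longrightarrow> smooth_on S (f i)) \<Longrightarrow> smooth_on S (\<lambda>x. \<Sum>i\<in>I. f i x)"
  unfolding smooth_on_def by (simp add: Ck_on_sum)

lemma smooth_on_prod:
  fixes f :: "_ \<Rightarrow> _ \<Rightarrow> real"
  shows "(\<And>i. i \<in> I \<Longrightarrow> smooth_on S (f i)) \<Longrightarrow> smooth_on S (\<lambda>x. \<Prod>i\<in>I. f i x)"
  by (induction I rule: infinite_finite_induct) (simp_all add: smooth_on_mult smooth_on_const)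

lemma smooth_on_power:
  fixes f :: "_ \<Rightarrow> real"
  shows "smooth_on S f \<Longrightarrow> smooth_on S (\<lambda>x. f x ^ m)"
  by (induction m) (simp_all add: smooth_on_mult smooth_on_const)

lemma smooth_on_minus: "smooth_on S f \<Longrightarrow> smooth_on S (\<lambda>x. - f x)"
  by (rule smooth_on_bounded_linear[OF bounded_linear_minus[OF bounded_linear_ident]])

lemma smooth_on_diff: "smooth_on S f \<Longrightarrow> smooth_on S g \<Longrightarrow> smooth_on S (\<lambda>x. f x - g x)"
  using smooth_on_add[OF _ smooth_on_minus] by fastforce

lemma smooth_on_fst: "smooth_on S f \<Longrightarrow> smooth_on S (\<lambda>x. fst (f x))"
  by (rule smooth_on_bounded_linear[OF bounded_linear_fst])

lemma smooth_on_snd: "smooth_on S f \<Longrightarrow> smooth_on S (\<lambda>x. snd (f x))"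
  by (rule smooth_on_bounded_linear[OF bounded_linear_snd])

lemma smooth_on_Pair:
  assumes "smooth_on S f" "smooth_on S g"
  shows "smooth_on S (\<lambda>x. (f x, g x))"
proof -
  have "bounded_linear (\<lambda>y. (y, 0))" "bounded_linear (\<lambda>z. (0, z))"
    by (intro bounded_linear_Pair bounded_linear_ident bounded_linear_zero)+
  then have "smooth_on S (\<lambda>x. (f x, 0) + (0, g x))"
    using assms by (intro smooth_on_add) (auto intro: smooth_on_bounded_linear)
  then show ?thesis by simp
qed

lemma smooth_on_vec_nth:
  fixes f :: "'a::euclidean_space \<Rightarrow> real ^ 'n"
  shows "smooth_on S f \<Longrightarrow> smooth_on S (\<lambda>x. f x $ i)"
  by (rule smooth_on_bounded_linear[OF bounded_linear_vec_nth])

lemma smooth_on_vec_lambda: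
  fixes f :: "'n::finite \<Rightarrow> 'a::euclidean_space \<Rightarrow> real"
  assumes "\<And>i. smooth_on S (f i)"
  shows "smooth_on S (\<lambda>x. \<chi> i. f i x)"
proof -
  have "smooth_on S (\<lambda>x. \<Sum>i\<in>UNIV. f i x *\<^sub>R axis i (1::real))"
    by (intro smooth_on_sum smooth_on_scaleR assms smooth_on_const)
  moreover have "(\<Sum>i\<in>UNIV. f i x *\<^sub>R axis i (1::real)) = (\<chi> i. f i x)" for x
    by (simp add: vec_eq_iff axis_def if_distrib cong: if_cong)
  ultimately show ?thesis by simp
qed

lemma smooth_on_det:
  fixes A :: "'a::euclidean_space \<Rightarrow> real ^ 'n ^ 'n"
  assumes "\<And>i j. smooth_on S (\<lambda>x. A x $ i $ j)"
  shows "smooth_on S (\<lambda>x. det (A x))"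
  unfolding det_def by (intro smooth_on_sum smooth_on_mult smooth_on_prod smooth_on_const assms)

lemma smooth_on_compose:
  assumes "smooth_on S f" "smooth_on S' g" "g ` S' \<subseteq> S"
  shows "smooth_on S' (\<lambda>x. f (g x))"
  using assms Ck_on_compose unfolding smooth_on_def by blast

lemma smooth_on_divide:
  fixes f g :: "'a::euclidean_space \<Rightarrow> real"
  assumes "smooth_on S f" "smooth_on S g" "\<And>x. x \<in> S \<Longrightarrow> g x \<noteq> 0"
  shows "smooth_on S (\<lambda>x. f x / g x)"
proof -
  have "smooth_on S (\<lambda>x. inverse (g x))"
    using assms unfolding smooth_on_def by (simp add: Ck_on_inverse)
  with assms(1) have "smooth_on S (\<lambda>x. f x * inverse (g x))"
    by (rule smooth_on_mult)
  then show ?thesis by (simp add: divide_inverse)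
qed

lemma smooth_on_integral:
  fixes G :: "'a::euclidean_space \<times> real \<Rightarrow> 'b::euclidean_space"
  assumes "open P" "smooth_on (P \<times> {0..1}) G"
  shows "smooth_on P (\<lambda>p. integral {0..1} (\<lambda>s. G (p, s)))"
  using assms unfolding smooth_on_def by (simp add: Ck_on_integral)

lemmas smooth_on_intros = smooth_on_const smooth_on_id smooth_on_add smooth_on_diff smooth_on_minus
  smooth_on_scaleR smooth_on_mult smooth_on_sum smooth_on_prod smooth_on_power smooth_on_fst
  smooth_on_snd smooth_on_Pair smooth_on_vec_nth smooth_on_vec_lambda

lemma smooth_on_has_derivative:
  assumes "open S" "smooth_on S f" "x \<in> S"
  shows "(f has_derivative frechet_derivative f (at x)) (at x)"
proof -
  have "Ck_on (Suc 0) S f" using assms(2) unfolding smooth_on_def by blast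
  then obtain f' where "\<And>y. y \<in> S \<Longrightarrow> (f has_derivative f' y) (at y within S)"
    by (rule Ck_on_SucE) blast
  from this[OF assms(3)] have "f differentiable (at x)"
    unfolding at_within_open[OF assms(3,1)] by (rule differentiableI)
  then show ?thesis by (simp add: frechet_derivative_works)
qed

lemma smooth_on_frechet_derivative_const:
  assumes "open S" "smooth_on S f"
  shows "smooth_on S (\<lambda>x. frechet_derivative f (at x) v)"
  unfolding smooth_on_def
proof
  fix m
  have "Ck_on (Suc m) S f" using assms(2) unfolding smooth_on_def by blast
  then obtain f' where f': "\<And>x. x \<in> S \<Longrightarrow> (f has_derivative f' x) (at x within S)"
      "\<And>v. Ck_on m S (\<lambda>x. f' x v)"
    by (rule Ck_on_SucE) blast
  have "f' x = frechet_derivative f (at x)" if "x \<in> S" for x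
    using f'(1)[OF that] frechet_derivative_at by (simp add: at_within_open[OF that assms(1)])
  then have "f' x v = frechet_derivative f (at x) v" if "x \<in> S" for x
    using that by simp
  from Ck_on_cong[THEN iffD1, OF this f'(2)]
  show "Ck_on m S (\<lambda>x. frechet_derivative f (at x) v)" .
qed

text \<open>
  The direction \<open>v x\<close> may vary with the point: in coordinates, the derivative in direction \<open>v x\<close> is
  a linear combination of partial derivatives with smooth coefficients.
\<close>

lemma smooth_on_frechet_derivative:
  assumes "open S" "smooth_on S f" "smooth_on S v"
  shows "smooth_on S (\<lambda>x. frechet_derivative f (at x) (v x))"
proof -
  have *: "smooth_on S (\<lambda>x. \<Sum>b\<in>Basis. (v x \<bullet> b) *\<^sub>R frechet_derivative f (at x) b)"
    by (intro smooth_on_sum smooth_on_scaleR smooth_on_frechet_derivative_const assms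
        smooth_on_bounded_linear[OF bounded_linear_inner_left])
  have "(\<Sum>b\<in>Basis. (v x \<bullet> b) *\<^sub>R frechet_derivative f (at x) b) = frechet_derivative f (at x) (v x)"
    if "x \<in> S" for x
  proof -
    have "linear (frechet_derivative f (at x))"
      using smooth_on_has_derivative[OF assms(1,2) that] by (rule has_derivative_linear)
    then have "frechet_derivative f (at x) (\<Sum>b\<in>Basis. (v x \<bullet> b) *\<^sub>R b) =
        (\<Sum>b\<in>Basis. (v x \<bullet> b) *\<^sub>R frechet_derivative f (at x) b)"
      by (simp add: linear_sum linear_cmul)
    then show ?thesis by (simp add: euclidean_representation)
  qed
  from smooth_on_cong[THEN iffD1, OF this *] show ?thesis .
qed

section \<open>Iterated derivatives and Taylor expansion along a line\<close>

lemma smooth_on_frechet_iter: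
  assumes "open S" "smooth_on S f"
  shows "smooth_on S (frechet_iter f vs)"
proof (induction vs)
  case Nil
  have "frechet_iter f [] = f" by (rule ext) simp
  with assms(2) show ?case by simp
next
  case (Cons v vs)
  have "frechet_iter f (v # vs) = (\<lambda>x. frechet_derivative (frechet_iter f vs) (at x) v)"
    by (rule ext) simp
  with smooth_on_frechet_derivative_const[OF assms(1) Cons, of v] show ?case
    by (simp only:)
qed

lemma frechet_iter_append: "frechet_iter f (vs @ ws) = frechet_iter (frechet_iter f ws) vs"
proof (induction vs)
  case Nil
  show ?case by (rule ext) simp
next
  case (Cons v vs)
  then show ?case by (intro ext) simp
qed

text \<open>This transfers the periodicity of the fields, which holds on \<open>D\<close> only, to their derivatives.\<close>

lemma frechet_iter_cong_open:
  assumes "open S" "\<And>x. x \<in> S \<Longrightarrow> f x = g x"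
  shows "x \<in> S \<Longrightarrow> frechet_iter f vs x = frechet_iter g vs x"
proof (induction vs arbitrary: x)
  case (Cons v vs)
  have "(frechet_iter f vs has_derivative h) (at x) \<longleftrightarrow> (frechet_iter g vs has_derivative h) (at x)" for h
    using has_derivative_transform_within_open[OF _ \<open>open S\<close> \<open>x \<in> S\<close>, of "frechet_iter f vs" h UNIV "frechet_iter g vs"]
      has_derivative_transform_within_open[OF _ \<open>open S\<close> \<open>x \<in> S\<close>, of "frechet_iter g vs" h UNIV "frechet_iter f vs"]
      Cons.IH by auto
  then show ?case by (simp add: frechet_derivative_def)
qed (simp add: assms(2))

text \<open>
  Taylor's formula with integral remainder for \<open>s \<mapsto> f (x + s \<tau> v)\<close> on \<open>[0, 1]\<close>. The remainder depends
  smoothly on \<open>x\<close> and \<open>\<tau>\<close> by \<open>smooth_on_integral\<close>; it is used for expansions in a direction of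
  space as well as in the direction of the parameter.
\<close>

lemma taylor_line:
  fixes f :: "'a::euclidean_space \<Rightarrow> 'b::euclidean_space"
  assumes "open S" "smooth_on S f" "\<And>s. s \<in> {0..1} \<Longrightarrow> x + (s * \<tau>) *\<^sub>R v \<in> S" "M > 0"
  shows "f (x + \<tau> *\<^sub>R v) =
    (\<Sum>j<M. (\<tau> ^ j / fact j) *\<^sub>R frechet_iter f (replicate j v) x) +
    \<tau> ^ M *\<^sub>R integral {0..1} (\<lambda>s. ((1 - s) ^ (M - 1) / fact (M - 1)) *\<^sub>R
      frechet_iter f (replicate M v) (x + (s * \<tau>) *\<^sub>R v))"
proof -
  define Df where "Df m s = \<tau> ^ m *\<^sub>R frechet_iter f (replicate m v) (x + (s * \<tau>) *\<^sub>R v)" for m s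
  have "(Df m has_vector_derivative Df (Suc m) s) (at s within {0..1})" if "0 \<le> s" "s \<le> 1" for m s
  proof -
    let ?g = "frechet_iter f (replicate m v)" and ?y = "x + (s * \<tau>) *\<^sub>R v"
    have "?y \<in> S" using assms(3) that by auto
    then have g: "(?g has_derivative frechet_derivative ?g (at ?y)) (at ?y)"
      using smooth_on_has_derivative smooth_on_frechet_iter assms(1,2) by blast
    have lin: "((\<lambda>s. x + (s * \<tau>) *\<^sub>R v) has_derivative (\<lambda>h. (h * \<tau>) *\<^sub>R v)) (at s within {0..1})"
      by (auto intro!: derivative_eq_intros)
    have "((\<lambda>s. ?g (x + (s * \<tau>) *\<^sub>R v)) has_derivative
        (\<lambda>h. frechet_derivative ?g (at ?y) ((h * \<tau>) *\<^sub>R v))) (at s within {0..1})"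
      by (rule has_derivative_compose[OF lin g])
    then have "(Df m has_derivative (\<lambda>h. \<tau> ^ m *\<^sub>R frechet_derivative ?g (at ?y) ((h * \<tau>) *\<^sub>R v)))
        (at s within {0..1})"
      unfolding Df_def by (rule has_derivative_scaleR_right)
    moreover have "frechet_derivative ?g (at ?y) ((h * \<tau>) *\<^sub>R v) = (h * \<tau>) *\<^sub>R frechet_derivative ?g (at ?y) v" for h
      using has_derivative_linear[OF g] by (rule linear_cmul)
    ultimately show ?thesis
      by (simp add: has_vector_derivative_def Df_def mult_ac)
  qed
  from Taylor_integral[of M Df "Df 0" 0 1, OF \<open>M > 0\<close> refl this]
  have "Df 0 1 = (\<Sum>j<M. (1 / fact j) *\<^sub>R Df j 0) +
      integral {0..1} (\<lambda>s. ((1 - s) ^ (M - 1) / fact (M - 1)) *\<^sub>R Df M s)"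
    by simp
  also have "(\<lambda>s. ((1 - s) ^ (M - 1) / fact (M - 1)) *\<^sub>R Df M s) = (\<lambda>s. \<tau> ^ M *\<^sub>R
      (((1 - s) ^ (M - 1) / fact (M - 1)) *\<^sub>R frechet_iter f (replicate M v) (x + (s * \<tau>) *\<^sub>R v)))"
    by (simp add: Df_def fun_eq_iff mult_ac)
  finally show ?thesis
    unfolding integral_cmul by (simp add: Df_def)
qed

section \<open>Asymptotic expansions in powers of the parameter\<close>

lemma eventually_nhds_isCont:
  "isCont f a \<Longrightarrow> open S \<Longrightarrow> f a \<in> S \<Longrightarrow> \<forall>\<^sub>F x in nhds a. f x \<in> S"
  unfolding isCont_def tendsto_at_iff_tendsto_nhds by (rule topological_tendstoD)

text \<open>
  A version of \<open>O(\<epsilon>\<^sup>M)\<close> whose quotient by \<open>\<epsilon>\<^sup>M\<close> is required to be continuous at \<open>0\<close>, and in which the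
  point \<open>\<epsilon> = 0\<close> is included. It suits remainders in integral form and makes Taylor coefficients
  unique.
\<close>

definition vanishes_to_order :: "nat \<Rightarrow> (real \<Rightarrow> 'b::real_normed_vector) \<Rightarrow> bool" where
  "vanishes_to_order M g \<longleftrightarrow> (\<exists>H. isCont H 0 \<and> (\<forall>\<^sub>F \<epsilon> in nhds 0. g \<epsilon> = \<epsilon> ^ M *\<^sub>R H \<epsilon>))"

lemma vanishes_to_orderI:
  "isCont H 0 \<Longrightarrow> (\<forall>\<^sub>F \<epsilon> in nhds 0. g \<epsilon> = \<epsilon> ^ M *\<^sub>R H \<epsilon>) \<Longrightarrow> vanishes_to_order M g"
  unfolding vanishes_to_order_def by blast

lemma vanishes_to_order_power:
  assumes "isCont H 0" "M \<le> n"
  shows "vanishes_to_order M (\<lambda>\<epsilon>. \<epsilon> ^ n *\<^sub>R H \<epsilon>)"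
proof (rule vanishes_to_orderI)
  show "isCont (\<lambda>\<epsilon>. \<epsilon> ^ (n - M) *\<^sub>R H \<epsilon>) 0"
    using assms by (auto intro!: continuous_intros)
  show "\<forall>\<^sub>F \<epsilon> in nhds 0. \<epsilon> ^ n *\<^sub>R H \<epsilon> = \<epsilon> ^ M *\<^sub>R (\<epsilon> ^ (n - M) *\<^sub>R H \<epsilon>)"
    using assms by (simp flip: power_add)
qed

lemma vanishes_to_order_zero: "vanishes_to_order M (\<lambda>\<epsilon>. 0)"
  by (rule vanishes_to_orderI[of "\<lambda>_. 0"]) simp_all

lemma vanishes_to_order_add:
  assumes "vanishes_to_order M f" "vanishes_to_order M g"
  shows "vanishes_to_order M (\<lambda>\<epsilon>. f \<epsilon> + g \<epsilon>)"
proof -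
  obtain F G where FG: "isCont F 0" "isCont G 0" "\<forall>\<^sub>F \<epsilon> in nhds 0. f \<epsilon> = \<epsilon> ^ M *\<^sub>R F \<epsilon>"
    "\<forall>\<^sub>F \<epsilon> in nhds 0. g \<epsilon> = \<epsilon> ^ M *\<^sub>R G \<epsilon>"
    using assms unfolding vanishes_to_order_def by blast
  have "\<forall>\<^sub>F \<epsilon> in nhds 0. f \<epsilon> + g \<epsilon> = \<epsilon> ^ M *\<^sub>R (F \<epsilon> + G \<epsilon>)"
    using FG(3,4) by eventually_elim (simp add: scaleR_add_right)
  from vanishes_to_orderI[OF _ this] FG(1,2) show ?thesis
    by (simp add: isCont_add)
qed

lemma vanishes_to_order_scaleR:
  assumes "vanishes_to_order M g" "isCont a 0"
  shows "vanishes_to_order M (\<lambda>\<epsilon>. a \<epsilon> *\<^sub>R g \<epsilon>)"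
proof -
  obtain G where G: "isCont G 0" "\<forall>\<^sub>F \<epsilon> in nhds 0. g \<epsilon> = \<epsilon> ^ M *\<^sub>R G \<epsilon>"
    using assms unfolding vanishes_to_order_def by blast
  have "\<forall>\<^sub>F \<epsilon> in nhds 0. a \<epsilon> *\<^sub>R g \<epsilon> = \<epsilon> ^ M *\<^sub>R (a \<epsilon> *\<^sub>R G \<epsilon>)"
    using G(2) by eventually_elim (simp add: mult_ac)
  from vanishes_to_orderI[OF _ this] G(1) assms(2) show ?thesis
    by (simp add: isCont_scaleR)
qed

lemma vanishes_to_order_shift:
  assumes "vanishes_to_order M g"
  shows "vanishes_to_order (n + M) (\<lambda>\<epsilon>. \<epsilon> ^ n *\<^sub>R g \<epsilon>)"
proof -
  obtain H where H: "isCont H 0" "\<forall>\<^sub>F \<epsilon> in nhds 0. g \<epsilon> = \<epsilon> ^ M *\<^sub>R H \<epsilon>"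
    using assms unfolding vanishes_to_order_def by blast
  from H(2) have "\<forall>\<^sub>F \<epsilon> in nhds 0. \<epsilon> ^ n *\<^sub>R g \<epsilon> = \<epsilon> ^ (n + M) *\<^sub>R H \<epsilon>"
    by eventually_elim (simp add: power_add)
  with H(1) show ?thesis by (rule vanishes_to_orderI)
qed

lemma vanishes_to_order_diff:
  assumes "vanishes_to_order M f" "vanishes_to_order M g"
  shows "vanishes_to_order M (\<lambda>\<epsilon>. f \<epsilon> - g \<epsilon>)"
  using vanishes_to_order_add[OF assms(1) vanishes_to_order_scaleR[OF assms(2), of "\<lambda>_. - 1"]] by simp

lemma vanishes_to_order_sum:
  "(\<And>i. i \<in> I \<Longrightarrow> vanishes_to_order M (f i)) \<Longrightarrow> vanishes_to_order M (\<lambda>\<epsilon>. \<Sum>i\<in>I. f i \<epsilon>)"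
  by (induction I rule: infinite_finite_induct)
    (simp_all add: vanishes_to_order_zero vanishes_to_order_add)

text \<open>
  Evaluation at \<open>0\<close> removes the constant coefficient; then one factor \<open>\<epsilon>\<close> cancels for \<open>\<epsilon> \<noteq> 0\<close>, and
  by continuity the cancelled identity persists at \<open>0\<close>.
\<close>

lemma vanishes_to_order_polynomial:
  fixes d :: "nat \<Rightarrow> 'b::real_normed_vector"
  shows "vanishes_to_order M (\<lambda>\<epsilon>. \<Sum>j<M. \<epsilon> ^ j *\<^sub>R d j) \<Longrightarrow> j < M \<Longrightarrow> d j = 0"
proof (induction M arbitrary: d j)
  case (Suc M)
  obtain H where H: "isCont H 0"
    "\<forall>\<^sub>F \<epsilon> in nhds 0. (\<Sum>j<Suc M. \<epsilon> ^ j *\<^sub>R d j) = \<epsilon> ^ Suc M *\<^sub>R H \<epsilon>"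
    using Suc.prems(1) unfolding vanishes_to_order_def by blast
  have shift: "(\<Sum>j<Suc M. \<epsilon> ^ j *\<^sub>R d j) = d 0 + \<epsilon> *\<^sub>R (\<Sum>j<M. \<epsilon> ^ j *\<^sub>R d (Suc j))" for \<epsilon>
    by (simp only: sum.lessThan_Suc_shift) (simp add: scaleR_right.sum)
  have "d 0 = 0"
    using eventually_nhds_x_imp_x[OF H(2)] by (simp only: shift) simp
  define K where "K \<epsilon> = (\<Sum>j<M. \<epsilon> ^ j *\<^sub>R d (Suc j)) - \<epsilon> ^ M *\<^sub>R H \<epsilon>" for \<epsilon>
  have "isCont K 0"
    unfolding K_def using H(1) by (intro continuous_intros)
  have *: "\<forall>\<^sub>F \<epsilon> in nhds 0. \<epsilon> *\<^sub>R K \<epsilon> = 0"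
    using H(2) by eventually_elim (simp only: shift \<open>d 0 = 0\<close>, simp add: K_def scaleR_diff_right)
  then have at0: "\<forall>\<^sub>F \<epsilon> in at 0. K \<epsilon> = 0"
    unfolding eventually_at_filter by eventually_elim auto
  then have "(K \<longlongrightarrow> 0) (at 0)"
    by (rule tendsto_eventually)
  then have "K 0 = 0"
    using \<open>isCont K 0\<close> unfolding isCont_def by (rule LIM_unique[rotated])
  with at0 have "\<forall>\<^sub>F \<epsilon> in nhds 0. K \<epsilon> = 0"
    by (simp add: eventually_nhds_conv_at)
  then have "vanishes_to_order M (\<lambda>\<epsilon>. \<Sum>j<M. \<epsilon> ^ j *\<^sub>R d (Suc j))"
    by (intro vanishes_to_orderI[OF H(1)]) (auto elim!: eventually_mono simp: K_def)
  from Suc.IH[OF this] have "d (Suc i) = 0" if "i < M" for i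
    using that .
  with \<open>d 0 = 0\<close> show ?case
    using Suc.prems(2) by (cases j) auto
qed simp

lemma taylor_coefficients_unique:
  assumes "vanishes_to_order M (\<lambda>\<epsilon>. g \<epsilon> - (\<Sum>j<M. \<epsilon> ^ j *\<^sub>R c j))"
    and "vanishes_to_order M (\<lambda>\<epsilon>. g \<epsilon> - (\<Sum>j<M. \<epsilon> ^ j *\<^sub>R d j))" and "j < M"
  shows "c j = d j"
proof -
  have "vanishes_to_order M (\<lambda>\<epsilon>. \<Sum>j<M. \<epsilon> ^ j *\<^sub>R (d j - c j))"
    using vanishes_to_order_diff[OF assms(1,2)]
    by (simp add: scaleR_diff_right sum_subtractf)
  from vanishes_to_order_polynomial[OF this assms(3)] show ?thesis by simp
qed

text \<open>
  A box of exponents suffices: each of the \<open>N\<close> one-dimensional Taylor expansions is cut off at order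
  \<open>M\<close>. As in \<open>bell_exponents\<close>, the values outside \<open>1, \<dots>, N\<close> are fixed to be \<open>0\<close>.
\<close>

definition expansion_exponents :: "nat \<Rightarrow> nat \<Rightarrow> (nat \<Rightarrow> nat) set" where
  "expansion_exponents N M = {b. \<forall>l. (l \<in> {1..N} \<longrightarrow> b l \<in> {..<M}) \<and> (l \<notin> {1..N} \<longrightarrow> b l = 0)}"

text \<open>
  The coefficient is that of the monomial with exponents \<open>b\<close> in a Bell polynomial \<open>B\<^bsub>p,q\<^esub>\<close>, divided
  by \<open>p!\<close>.
\<close>

definition expansion_term ::
  "('a::real_normed_vector \<Rightarrow> 'b::real_normed_vector) \<Rightarrow> 'a \<Rightarrow> (nat \<Rightarrow> 'a) \<Rightarrow> nat \<Rightarrow> (nat \<Rightarrow> nat) \<Rightarrow> 'b" where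
  "expansion_term f z v N b = (\<Prod>l = 1..N. 1 / (fact (b l) * fact l ^ b l)) *\<^sub>R
     frechet_iter f (concat (map (\<lambda>l. replicate (b l) (v l)) [1..<Suc N])) z"

lemma finite_expansion_exponents: "finite (expansion_exponents N M)"
  unfolding expansion_exponents_def by (rule finite_set_of_finite_funs) simp_all

lemma expansion_exponents_iff:
  "b \<in> expansion_exponents N M \<longleftrightarrow> (\<forall>l. if 1 \<le> l \<and> l \<le> N then b l < M else b l = 0)"
proof -
  have "(if 1 \<le> l \<and> l \<le> N then b l < M else b l = 0) \<longleftrightarrow>
      (l \<in> {1..N} \<longrightarrow> b l \<in> {..<M}) \<and> (l \<notin> {1..N} \<longrightarrow> b l = 0)" for l
    by auto
  then show ?thesis by (simp only: expansion_exponents_def mem_Collect_eq)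
qed

lemma expansion_term_Suc:
  "expansion_term f z v (Suc N) (b(Suc N := a)) =
     (1 / (fact a * fact (Suc N) ^ a)) *\<^sub>R expansion_term (frechet_iter f (replicate a (v (Suc N)))) z v N b"
proof -
  define b' where "b' = b(Suc N := a)"
  have b': "b' (Suc N) = a" "\<And>l. l \<le> N \<Longrightarrow> b' l = b l"
    by (simp_all add: b'_def)
  have prod: "(\<Prod>l = 1..Suc N. 1 / (fact (b' l) * fact l ^ b' l)) =
      (\<Prod>l = 1..N. 1 / (fact (b l) * fact l ^ b l)) * (1 / (fact a * fact (Suc N) ^ a) :: real)"
    by (simp add: b' cong: prod.cong_simp)
  have "map (\<lambda>l. replicate (b' l) (v l)) [1..<Suc N] = map (\<lambda>l. replicate (b l) (v l)) [1..<Suc N]"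
    by (rule map_cong) (auto simp: b')
  moreover have "[1..<Suc (Suc N)] = [1..<Suc N] @ [Suc N]" by simp
  ultimately have list: "concat (map (\<lambda>l. replicate (b' l) (v l)) [1..<Suc (Suc N)]) =
      concat (map (\<lambda>l. replicate (b l) (v l)) [1..<Suc N]) @ replicate a (v (Suc N))"
    by (simp only: map_append concat_append) (simp add: b')
  show ?thesis
    unfolding expansion_term_def b'_def[symmetric] prod list frechet_iter_append scaleR_scaleR
    by (simp only: mult.commute)
qed

lemma sum_expansion_exponents_Suc:
  "(\<Sum>b\<in>expansion_exponents (Suc N) M. h b) =
     (\<Sum>a<M. \<Sum>b\<in>expansion_exponents N M. h (b(Suc N := a)))"
proof -
  have "(\<Sum>a<M. \<Sum>b\<in>expansion_exponents N M. h (b(Suc N := a))) =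
      (\<Sum>(a, b)\<in>{..<M} \<times> expansion_exponents N M. h (b(Suc N := a)))"
    by (simp add: sum.cartesian_product)
  also have "\<dots> = (\<Sum>b\<in>expansion_exponents (Suc N) M. h b)"
  proof (rule sum.reindex_bij_witness[of _ "\<lambda>b. (b (Suc N), b(Suc N := 0))" "\<lambda>(a, b). b(Suc N := a)"])
    fix p assume "p \<in> {..<M} \<times> expansion_exponents N M"
    then obtain a b where p: "p = (a, b)" "a < M" "b \<in> expansion_exponents N M" by auto
    then have b: "if 1 \<le> l \<and> l \<le> N then b l < M else b l = 0" for l
      unfolding expansion_exponents_iff by blast
    from b[of "Suc N"] have "b (Suc N) = 0" by simp
    then show "((case p of (a, b) \<Rightarrow> b(Suc N := a)) (Suc N),
        (case p of (a, b) \<Rightarrow> b(Suc N := a))(Suc N := 0)) = p"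
      by (simp add: p fun_upd_idem)
    show "(case p of (a, b) \<Rightarrow> b(Suc N := a)) \<in> expansion_exponents (Suc N) M"
      unfolding expansion_exponents_iff p(1) prod.case
    proof
      fix l
      show "if 1 \<le> l \<and> l \<le> Suc N then (b(Suc N := a)) l < M else (b(Suc N := a)) l = 0"
        using b[of l] p(2) by (cases "l = Suc N") (auto split: if_splits)
    qed
  next
    fix b assume "b \<in> expansion_exponents (Suc N) M"
    then have b: "if 1 \<le> l \<and> l \<le> Suc N then b l < M else b l = 0" for l
      unfolding expansion_exponents_iff by blast
    have "b(Suc N := 0) \<in> expansion_exponents N M"
      unfolding expansion_exponents_iff
    proof
      fix l
      show "if 1 \<le> l \<and> l \<le> N then (b(Suc N := 0)) l < M else (b(Suc N := 0)) l = 0"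
        using b[of l] by (cases "l = Suc N") (auto split: if_splits)
    qed
    then show "(b (Suc N), b(Suc N := 0)) \<in> {..<M} \<times> expansion_exponents N M"
      using b[of "Suc N"] by simp
  qed auto
  finally show ?thesis by simp
qed

text \<open>
  Induction on the number \<open>N\<close> of vectors: the Taylor formula in direction \<open>v\<^bsub>N+1\<^esub>\<close> is applied at the
  moving point \<open>w(\<epsilon>) = z + \<Sum>\<^bsub>m\<le>N\<^esub> \<epsilon>\<^sup>m v\<^sub>m / m!\<close>, and the induction hypothesis to the resulting
  directional derivatives of \<open>f\<close>.
\<close>

lemma multivariate_expansion:
  fixes f :: "'a::euclidean_space \<Rightarrow> 'b::euclidean_space"
  assumes "open S" "z \<in> S" "M > 0"
  shows "smooth_on S f \<Longrightarrow> vanishes_to_order M (\<lambda>\<epsilon>. f (z + (\<Sum>m = 1..N. (\<epsilon> ^ m / fact m) *\<^sub>R v m)) -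
    (\<Sum>b\<in>expansion_exponents N M. \<epsilon> ^ (\<Sum>l = 1..N. l * b l) *\<^sub>R expansion_term f z v N b))"
proof (induction N arbitrary: f)
  case 0
  have "expansion_exponents 0 M = {\<lambda>_. 0}"
    by (auto simp: expansion_exponents_def)
  then show ?case by (simp add: expansion_term_def vanishes_to_order_zero)
next
  case (Suc N)
  define w where "w \<epsilon> = z + (\<Sum>m = 1..N. (\<epsilon> ^ m / fact m) *\<^sub>R v m)" for \<epsilon> :: real
  define \<tau> where "\<tau> \<epsilon> = \<epsilon> ^ Suc N / fact (Suc N)" for \<epsilon> :: real
  define u where "u = v (Suc N)"
  define g where "g a = frechet_iter f (replicate a u)" for a
  define K where "K p = integral {0..1} (\<lambda>s. ((1 - s) ^ (M - 1) / fact (M - 1)) *\<^sub>R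
      g M (fst p + (s * snd p) *\<^sub>R u))" for p :: "'a \<times> real"
  have g: "smooth_on S (g a)" for a
    unfolding g_def by (rule smooth_on_frechet_iter[OF assms(1) Suc.prems])
  obtain r where r: "r > 0" "ball z r \<subseteq> S"
    using assms(1,2) open_contains_ball by blast
  define c where "c = norm u + 1"
  have "c > 0" "norm u \<le> c" by (simp_all add: c_def add_nonneg_pos)
  \<comment> \<open>The radius \<open>\<delta>\<close> is chosen so that, for \<open>w\<close> within \<open>r / 2\<close> of \<open>z\<close> and \<open>\<bar>\<tau>\<bar> < \<delta>\<close>, the segment
    from \<open>w\<close> to \<open>w + \<tau> u\<close> stays in the ball of radius \<open>r\<close>.\<close>
  define \<delta> where "\<delta> = r / (2 * c)"
  have "\<delta> > 0" using r(1) \<open>c > 0\<close> by (simp add: \<delta>_def)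
  define P where "P = ball z (r / 2) \<times> ball (0::real) \<delta>"
  have "open P" by (simp add: P_def open_Times)
  have seg: "fst p + (s * snd p) *\<^sub>R u \<in> S" if "p \<in> P" "s \<in> {0..1}" for p s
  proof -
    have "\<bar>s * snd p\<bar> \<le> 1 * \<delta>"
      unfolding abs_mult using that by (intro mult_mono) (auto simp: P_def)
    then have "norm ((s * snd p) *\<^sub>R u) \<le> \<delta> * c"
      unfolding norm_scaleR using \<open>\<delta> > 0\<close> \<open>norm u \<le> c\<close> by (intro mult_mono) auto
    also have "\<dots> = r / 2"
      using \<open>c > 0\<close> by (simp add: \<delta>_def)
    finally have "norm ((s * snd p) *\<^sub>R u) \<le> r / 2" .
    moreover have "dist z (fst p) < r / 2" using that(1) by (auto simp: P_def)
    moreover have "dist z (fst p + (s * snd p) *\<^sub>R u) \<le> dist z (fst p) + norm ((s * snd p) *\<^sub>R u)"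
      using dist_triangle[of z "fst p + (s * snd p) *\<^sub>R u" "fst p"] by (simp add: dist_norm)
    ultimately have "fst p + (s * snd p) *\<^sub>R u \<in> ball z r" by simp
    then show ?thesis using r(2) by blast
  qed
  have "smooth_on P K"
  proof -
    have "smooth_on (P \<times> {0..1}) (\<lambda>q. ((1 - snd q) ^ (M - 1) * (1 / fact (M - 1))) *\<^sub>R
        g M (fst (fst q) + (snd q * snd (fst q)) *\<^sub>R u))"
      by (intro smooth_on_intros smooth_on_compose[OF g]) (use seg in auto)
    from smooth_on_integral[OF \<open>open P\<close> this] show ?thesis
      unfolding K_def by simp
  qed
  have "(\<Sum>m = 1..N. ((0::real) ^ m / fact m) *\<^sub>R v m) = 0"
    by (rule sum.neutral) (auto simp: power_0_left)
  then have "w 0 = z" "\<tau> 0 = 0"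
    by (simp_all add: w_def \<tau>_def)
  have cont: "isCont w 0" "isCont \<tau> 0"
    unfolding w_def \<tau>_def by (auto intro!: continuous_intros)
  have wP: "(w 0, \<tau> 0) \<in> P"
    using r(1) \<open>\<delta> > 0\<close> by (simp add: P_def \<open>w 0 = z\<close> \<open>\<tau> 0 = 0\<close>)
  have "isCont K (w 0, \<tau> 0)"
    using smooth_on_imp_continuous_on[OF \<open>smooth_on P K\<close>] \<open>open P\<close> wP
    by (simp add: continuous_on_eq_continuous_at)
  then have contK: "isCont (\<lambda>\<epsilon>. K (w \<epsilon>, \<tau> \<epsilon>)) 0"
    using cont by (intro isCont_o2[where f = "\<lambda>\<epsilon>. (w \<epsilon>, \<tau> \<epsilon>)" and g = K] continuous_intros)
  have evP: "\<forall>\<^sub>F \<epsilon> in nhds 0. (w \<epsilon>, \<tau> \<epsilon>) \<in> P"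
    using eventually_nhds_isCont[of 0 "\<lambda>\<epsilon>. (w \<epsilon>, \<tau> \<epsilon>)" P] cont \<open>open P\<close> wP
    by (auto intro!: continuous_intros)
  have taylor: "f (w \<epsilon> + \<tau> \<epsilon> *\<^sub>R u) = (\<Sum>a<M. (\<tau> \<epsilon> ^ a / fact a) *\<^sub>R g a (w \<epsilon>)) + \<tau> \<epsilon> ^ M *\<^sub>R K (w \<epsilon>, \<tau> \<epsilon>)"
    if "(w \<epsilon>, \<tau> \<epsilon>) \<in> P" for \<epsilon>
    using taylor_line[OF assms(1) Suc.prems seg[OF that, simplified] assms(3)] by (simp add: g_def K_def)
  have "vanishes_to_order M (\<lambda>\<epsilon>. (f (w \<epsilon> + \<tau> \<epsilon> *\<^sub>R u) - (\<Sum>a<M. (\<tau> \<epsilon> ^ a / fact a) *\<^sub>R g a (w \<epsilon>))))"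
  proof (rule vanishes_to_orderI)
    show "isCont (\<lambda>\<epsilon>. (\<epsilon> ^ (N * M) / fact (Suc N) ^ M) *\<^sub>R K (w \<epsilon>, \<tau> \<epsilon>)) 0"
      using contK by (auto intro!: continuous_intros)
    have "\<tau> \<epsilon> ^ M = \<epsilon> ^ M * (\<epsilon> ^ (N * M) / fact (Suc N) ^ M)" for \<epsilon>
      by (simp add: \<tau>_def power_divide power_mult_distrib flip: power_mult power_add)
    with evP taylor show "\<forall>\<^sub>F \<epsilon> in nhds 0. f (w \<epsilon> + \<tau> \<epsilon> *\<^sub>R u) - (\<Sum>a<M. (\<tau> \<epsilon> ^ a / fact a) *\<^sub>R g a (w \<epsilon>)) =
        \<epsilon> ^ M *\<^sub>R ((\<epsilon> ^ (N * M) / fact (Suc N) ^ M) *\<^sub>R K (w \<epsilon>, \<tau> \<epsilon>))"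
      by (auto elim!: eventually_mono)
  qed
  moreover have "vanishes_to_order M (\<lambda>\<epsilon>. \<Sum>a<M. (\<tau> \<epsilon> ^ a / fact a) *\<^sub>R (g a (w \<epsilon>) -
      (\<Sum>b\<in>expansion_exponents N M. \<epsilon> ^ (\<Sum>l = 1..N. l * b l) *\<^sub>R expansion_term (g a) z v N b)))"
    using Suc.IH[OF g] cont(2)
    by (intro vanishes_to_order_sum vanishes_to_order_scaleR) (auto simp: w_def intro!: continuous_intros)
  ultimately have main: "vanishes_to_order M (\<lambda>\<epsilon>.
      (f (w \<epsilon> + \<tau> \<epsilon> *\<^sub>R u) - (\<Sum>a<M. (\<tau> \<epsilon> ^ a / fact a) *\<^sub>R g a (w \<epsilon>))) +
      (\<Sum>a<M. (\<tau> \<epsilon> ^ a / fact a) *\<^sub>R (g a (w \<epsilon>) -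
      (\<Sum>b\<in>expansion_exponents N M. \<epsilon> ^ (\<Sum>l = 1..N. l * b l) *\<^sub>R expansion_term (g a) z v N b))))"
    by (rule vanishes_to_order_add)
  have "(\<Sum>b\<in>expansion_exponents (Suc N) M. \<epsilon> ^ (\<Sum>l = 1..Suc N. l * b l) *\<^sub>R expansion_term f z v (Suc N) b) =
      (\<Sum>a<M. (\<tau> \<epsilon> ^ a / fact a) *\<^sub>R
        (\<Sum>b\<in>expansion_exponents N M. \<epsilon> ^ (\<Sum>l = 1..N. l * b l) *\<^sub>R expansion_term (g a) z v N b))" for \<epsilon>
  proof -
    have wt: "(\<Sum>l = 1..Suc N. l * (b(Suc N := a)) l) = (\<Sum>l = 1..N. l * b l) + Suc N * a" for a b
    proof -
      have "(\<Sum>l = 1..N. l * (b(Suc N := a)) l) = (\<Sum>l = 1..N. l * b l)"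
        by (rule sum.cong) auto
      then show ?thesis by simp
    qed
    have "\<tau> \<epsilon> ^ a / fact a = \<epsilon> ^ (Suc N * a) * (1 / (fact a * fact (Suc N) ^ a))" for a
      by (simp only: \<tau>_def power_divide power_mult) (simp add: field_simps)
    then have "\<epsilon> ^ (\<Sum>l = 1..Suc N. l * (b(Suc N := a)) l) *\<^sub>R expansion_term f z v (Suc N) (b(Suc N := a)) =
       (\<tau> \<epsilon> ^ a / fact a) *\<^sub>R (\<epsilon> ^ (\<Sum>l = 1..N. l * b l) *\<^sub>R expansion_term (g a) z v N b)" for a b
      unfolding expansion_term_Suc wt g_def u_def by (simp only: power_add scaleR_scaleR mult_ac)
    then show ?thesis
      unfolding sum_expansion_exponents_Suc by (simp only: scaleR_right.sum)
  qed
  then have "(f (w \<epsilon> + \<tau> \<epsilon> *\<^sub>R u) - (\<Sum>a<M. (\<tau> \<epsilon> ^ a / fact a) *\<^sub>R g a (w \<epsilon>))) +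
      (\<Sum>a<M. (\<tau> \<epsilon> ^ a / fact a) *\<^sub>R (g a (w \<epsilon>) -
      (\<Sum>b\<in>expansion_exponents N M. \<epsilon> ^ (\<Sum>l = 1..N. l * b l) *\<^sub>R expansion_term (g a) z v N b))) =
      f (z + (\<Sum>m = 1..Suc N. (\<epsilon> ^ m / fact m) *\<^sub>R v m)) -
      (\<Sum>b\<in>expansion_exponents (Suc N) M. \<epsilon> ^ (\<Sum>l = 1..Suc N. l * b l) *\<^sub>R expansion_term f z v (Suc N) b)" for \<epsilon>
    by (simp add: scaleR_diff_right sum_subtractf w_def \<tau>_def u_def add.assoc)
  with main show ?case by simp
qed

section \<open>The expansion along a polynomial curve and Bell polynomials\<close>

text \<open>
  The case \<open>N = 1\<close> of \<open>multivariate_expansion\<close>.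
\<close>

lemma taylor_expansion:
  fixes f :: "'a::euclidean_space \<Rightarrow> 'b::euclidean_space"
  assumes "open S" "x \<in> S" "smooth_on S f" "M > 0"
  shows "vanishes_to_order M (\<lambda>\<epsilon>. f (x + \<epsilon> *\<^sub>R v) -
    (\<Sum>j<M. \<epsilon> ^ j *\<^sub>R ((1 / fact j) *\<^sub>R frechet_iter f (replicate j v) x)))"
proof -
  have "expansion_exponents 0 M = {\<lambda>_. 0}"
    by (auto simp: expansion_exponents_def)
  then have "(\<Sum>b\<in>expansion_exponents (Suc 0) M. \<epsilon> ^ (\<Sum>l = 1..Suc 0. l * b l) *\<^sub>R expansion_term f x (\<lambda>_. v) (Suc 0) b) =
      (\<Sum>j<M. \<epsilon> ^ j *\<^sub>R ((1 / fact j) *\<^sub>R frechet_iter f (replicate j v) x))" for \<epsilon>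
    unfolding sum_expansion_exponents_Suc expansion_term_Suc by (simp add: expansion_term_def)
  with multivariate_expansion[OF assms(1,2,4,3), where N = "Suc 0" and v = "\<lambda>_. v"] show ?thesis
    by simp
qed

text \<open>
  The bound \<open>j - m + 1\<close> on the indices in a Bell polynomial is automatic: subtracting the two
  constraints gives \<open>\<Sum> (l - 1) b\<^sub>l = j - m\<close>, so \<open>b\<^sub>l\<close> vanishes for \<open>l - 1 > j - m\<close>.
\<close>

lemma bell_exponents_eq:
  assumes "1 \<le> m" "m \<le> j" "j \<le> N"
  shows "bell_exponents j m = {b. (\<forall>l. l \<notin> {1..N} \<longrightarrow> b l = 0) \<and>
    (\<Sum>l = 1..N. l * b l) = j \<and> (\<Sum>l = 1..N. b l) = m}"
proof -
  have sub: "{1..j - m + 1} \<subseteq> {1..N}" using assms by auto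
  have sums: "(\<Sum>l = 1..j - m + 1. l * b l) = (\<Sum>l = 1..N. l * b l)"
      "(\<Sum>l = 1..j - m + 1. b l) = (\<Sum>l = 1..N. b l)"
    if "\<forall>l. l \<notin> {1..j - m + 1} \<longrightarrow> b l = 0" for b :: "nat \<Rightarrow> nat"
    by (rule sum.mono_neutral_left[OF _ sub]; use that in simp)+
  show ?thesis
  proof (intro set_eqI iffI)
    fix b assume "b \<in> bell_exponents j m"
    then have b: "\<forall>l. l \<notin> {1..j - m + 1} \<longrightarrow> b l = 0"
        "(\<Sum>l = 1..j - m + 1. l * b l) = j" "(\<Sum>l = 1..j - m + 1. b l) = m"
      unfolding bell_exponents_def by blast+
    have "b l = 0" if "l \<notin> {1..N}" for l
      using b(1) sub that by blast
    moreover have "(\<Sum>l = 1..N. l * b l) = j" "(\<Sum>l = 1..N. b l) = m"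
      using sums[of b, OF b(1)] b(2,3) by (simp_all only:)
    ultimately show "b \<in> {b. (\<forall>l. l \<notin> {1..N} \<longrightarrow> b l = 0) \<and>
        (\<Sum>l = 1..N. l * b l) = j \<and> (\<Sum>l = 1..N. b l) = m}"
      by blast
  next
    fix b assume "b \<in> {b. (\<forall>l. l \<notin> {1..N} \<longrightarrow> b l = 0) \<and>
        (\<Sum>l = 1..N. l * b l) = j \<and> (\<Sum>l = 1..N. b l) = m}"
    then have b: "\<And>l. l \<notin> {1..N} \<Longrightarrow> b l = 0"
        "(\<Sum>l = 1..N. l * b l) = j" "(\<Sum>l = 1..N. b l) = m"
      by blast+
    have "(\<Sum>l = 1..N. (l - 1) * b l) + m = j"
      unfolding b(2,3)[symmetric] sum.distrib[symmetric]
      by (rule sum.cong) (auto simp: algebra_simps)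
    then have le: "(l - 1) * b l \<le> j - m" if "l \<in> {1..N}" for l
      using member_le_sum[of l "{1..N}" "\<lambda>l. (l - 1) * b l"] that by simp
    have "b l = 0" if "l \<notin> {1..j - m + 1}" for l
    proof (rule ccontr)
      assume "b l \<noteq> 0"
      then have l: "l \<in> {1..N}"
        using b(1)[of l] by metis
      have "(l - 1) * 1 \<le> (l - 1) * b l"
        using \<open>b l \<noteq> 0\<close> by (intro mult_left_mono) auto
      with le[OF l] have "l - 1 \<le> j - m" by linarith
      with l that show False by auto
    qed
    then have zero: "\<forall>l. l \<notin> {1..j - m + 1} \<longrightarrow> b l = 0" by blast
    moreover have "(\<Sum>l = 1..j - m + 1. l * b l) = j" "(\<Sum>l = 1..j - m + 1. b l) = m"
      using sums[of b, OF zero] b(2,3) by (simp_all only:)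
    ultimately show "b \<in> bell_exponents j m"
      unfolding bell_exponents_def by blast
  qed
qed

lemma bell_apply_eq_expansion_terms:
  assumes "1 \<le> m" "m \<le> j" "j \<le> N"
  shows "bell_apply f z j m v = fact j *\<^sub>R (\<Sum>b\<in>bell_exponents j m. expansion_term f z v N b)"
proof -
  have "bell_coeff j m b *\<^sub>R frechet_iter f (concat (map (\<lambda>l. replicate (b l) (v l)) [1..<j - m + 2])) z =
      fact j *\<^sub>R expansion_term f z v N b" if b: "b \<in> bell_exponents j m" for b
  proof -
    have zero: "b l = 0" if "l \<notin> {1..j - m + 1}" for l
      using b that unfolding bell_exponents_def by blast
    have sub: "{1..j - m + 1} \<subseteq> {1..N}" using assms by auto
    have "(\<Prod>l = 1..N. 1 / (fact (b l) * fact l ^ b l) :: real) = (\<Prod>l = 1..j - m + 1. 1 / (fact (b l) * fact l ^ b l))"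
      using zero sub by (intro prod.mono_neutral_right) auto
    then have "bell_coeff j m b = fact j * (\<Prod>l = 1..N. 1 / (fact (b l) * fact l ^ b l))"
      unfolding bell_coeff_def by (simp add: prod_dividef power_one_over prod.distrib divide_simps)
    moreover have "concat (map (\<lambda>l. replicate (b l) (v l)) [1..<j - m + 2]) =
        concat (map (\<lambda>l. replicate (b l) (v l)) [1..<Suc N])"
    proof -
      have "[1..<Suc N] = [1..<j - m + 2] @ [j - m + 2..<Suc N]"
        using assms upt_add_eq_append[of 1 "j - m + 2" "Suc N - (j - m + 2)"] by simp
      moreover have "concat (map (\<lambda>l. replicate (b l) (v l)) [j - m + 2..<Suc N]) = []"
        using zero by auto
      ultimately show ?thesis by (simp only: map_append concat_append append_Nil2)
    qed
    ultimately show ?thesis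
      unfolding expansion_term_def by (simp only: scaleR_scaleR)
  qed
  then show ?thesis
    unfolding bell_apply_def scaleR_right.sum by (rule sum.cong[OF refl])
qed

text \<open>
  The coefficient of \<open>\<epsilon>\<^sup>j\<close> in \<open>f (z + \<Sum> \<epsilon>\<^sup>m v\<^sub>m / m!)\<close>, as \<open>faa_di_bruno\<close> shows. For \<open>j = 0\<close> the Bell sum
  over \<open>{1..j}\<close> is empty, hence the separate case.
\<close>

definition expansion_coeff ::
  "('a::real_normed_vector \<Rightarrow> 'b::real_normed_vector) \<Rightarrow> 'a \<Rightarrow> (nat \<Rightarrow> 'a) \<Rightarrow> nat \<Rightarrow> 'b" where
  "expansion_coeff f z v j =
     (if j = 0 then f z else (1 / fact j) *\<^sub>R (\<Sum>m = 1..j. bell_apply f z j m v))"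

text \<open>
  Grouping the exponents of weight \<open>j = \<Sum> l b\<^sub>l\<close> by their size \<open>m = \<Sum> b\<^sub>l\<close> produces the partial Bell
  polynomials \<open>B\<^bsub>j,m\<^esub>\<close> with \<open>1 \<le> m \<le> j\<close>.
\<close>

lemma sum_expansion_terms_of_weight:
  assumes "j < M" "j \<le> N"
  shows "(\<Sum>b | b \<in> expansion_exponents N M \<and> (\<Sum>l = 1..N. l * b l) = j. expansion_term f z v N b) =
    expansion_coeff f z v j"
proof (cases "j = 0")
  case True
  have "{b \<in> expansion_exponents N M. (\<Sum>l = 1..N. l * b l) = 0} = {\<lambda>_. 0}"
    using assms True by (fastforce simp: expansion_exponents_def)
  moreover have nil: "concat (map (\<lambda>l. []) xs) = []" for xs :: "nat list"
    by simp
  ultimately show ?thesis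
    unfolding True expansion_coeff_def by (simp add: expansion_term_def nil del: upt_Suc)
next
  case False
  let ?B = "{b \<in> expansion_exponents N M. (\<Sum>l = 1..N. l * b l) = j}"
  have fin: "finite ?B"
    by (rule finite_subset[OF _ finite_expansion_exponents]) auto
  have le: "(\<Sum>l = 1..N. b l) \<le> (\<Sum>l = 1..N. l * b l)" for b :: "nat \<Rightarrow> nat"
    by (intro sum_mono) auto
  have "(\<lambda>b. \<Sum>l = 1..N. b l) ` ?B \<subseteq> {1..j}"
  proof safe
    fix b assume j: "j = (\<Sum>l = 1..N. l * b l)"
    have "(\<Sum>l = 1..N. b l) \<noteq> 0"
    proof
      assume "(\<Sum>l = 1..N. b l) = 0"
      then have "(\<Sum>l = 1..N. l * b l) = 0" by simp
      with j False show False by simp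
    qed
    with le[of b] show "(\<Sum>l = 1..N. b l) \<in> {1..\<Sum>l = 1..N. l * b l}"
      unfolding atLeastAtMost_iff by linarith
  qed
  from sum.group[OF fin _ this, of "expansion_term f z v N"]
  have "(\<Sum>b\<in>?B. expansion_term f z v N b) =
      (\<Sum>m = 1..j. \<Sum>b | b \<in> ?B \<and> (\<Sum>l = 1..N. b l) = m. expansion_term f z v N b)"
    by simp
  also have "\<dots> = (\<Sum>m = 1..j. (1 / fact j) *\<^sub>R bell_apply f z j m v)"
  proof (rule sum.cong[OF refl])
    fix m assume m: "m \<in> {1..j}"
    have "{b \<in> ?B. (\<Sum>l = 1..N. b l) = m} = bell_exponents j m"
    proof -
      have "b l < M" if "(\<Sum>l = 1..N. b l) = m" "l \<in> {1..N}" for b l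
        using member_le_sum[of l "{1..N}" b] that m assms by simp
      then show ?thesis
        using m assms by (subst bell_exponents_eq[of m j N]) (auto simp: expansion_exponents_def)
    qed
    then show "(\<Sum>b | b \<in> ?B \<and> (\<Sum>l = 1..N. b l) = m. expansion_term f z v N b) =
        (1 / fact j) *\<^sub>R bell_apply f z j m v"
      using m assms by (simp add: bell_apply_eq_expansion_terms[of m j N])
  qed
  finally show ?thesis
    using False by (simp add: expansion_coeff_def scaleR_right.sum)
qed

text \<open>
  The formula of Faa di Bruno in asymptotic form: in \<open>multivariate_expansion\<close> the terms of weight at
  least \<open>M\<close> are negligible, and the others are grouped by weight. The condition \<open>M \<le> N + 1\<close> ensures
  that every vector that can contribute below order \<open>M\<close> is present in the curve.
\<close>

lemma faa_di_bruno:
  fixes f :: "'a::euclidean_space \<Rightarrow> 'b::euclidean_space"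
  assumes "open S" "z \<in> S" "smooth_on S f" "M > 0" "M \<le> Suc N"
  shows "vanishes_to_order M (\<lambda>\<epsilon>. f (z + (\<Sum>m = 1..N. (\<epsilon> ^ m / fact m) *\<^sub>R v m)) -
    (\<Sum>j<M. \<epsilon> ^ j *\<^sub>R expansion_coeff f z v j))"
proof -
  let ?E = "expansion_exponents N M" and ?wt = "\<lambda>b. \<Sum>l = 1..N. l * b l"
  let ?h = "\<lambda>\<epsilon> b. \<epsilon> ^ ?wt b *\<^sub>R expansion_term f z v N b"
  have fin: "finite {b \<in> ?E. P b}" for P
    by (rule finite_subset[OF _ finite_expansion_exponents]) auto
  have split: "(\<Sum>b\<in>?E. ?h \<epsilon> b) =
      (\<Sum>b | b \<in> ?E \<and> ?wt b < M. ?h \<epsilon> b) + (\<Sum>b | b \<in> ?E \<and> \<not> ?wt b < M. ?h \<epsilon> b)" for \<epsilon>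
    using sum.union_disjoint[OF fin[of "\<lambda>b. ?wt b < M"] fin[of "\<lambda>b. \<not> ?wt b < M"], of "?h \<epsilon>"]
    by (auto intro!: sum.cong simp flip: Collect_disj_eq simp: conj_disj_distribL[symmetric] Collect_conj_eq[symmetric])
  have low: "(\<Sum>b | b \<in> ?E \<and> ?wt b < M. ?h \<epsilon> b) = (\<Sum>j<M. \<epsilon> ^ j *\<^sub>R expansion_coeff f z v j)" for \<epsilon>
  proof -
    have "?wt ` {b \<in> ?E. ?wt b < M} \<subseteq> {..<M}" by auto
    from sum.group[OF fin _ this, of "?h \<epsilon>"]
    have "(\<Sum>b | b \<in> ?E \<and> ?wt b < M. ?h \<epsilon> b) =
        (\<Sum>j<M. \<Sum>b | b \<in> {b \<in> ?E. ?wt b < M} \<and> ?wt b = j. ?h \<epsilon> b)"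
      by simp
    also have "\<dots> = (\<Sum>j<M. \<epsilon> ^ j *\<^sub>R expansion_coeff f z v j)"
    proof (rule sum.cong[OF refl])
      fix j assume j: "j \<in> {..<M}"
      then have "{b \<in> {b \<in> ?E. ?wt b < M}. ?wt b = j} = {b. b \<in> ?E \<and> ?wt b = j}" by auto
      then have "(\<Sum>b | b \<in> {b \<in> ?E. ?wt b < M} \<and> ?wt b = j. ?h \<epsilon> b) =
          (\<Sum>b | b \<in> ?E \<and> ?wt b = j. \<epsilon> ^ j *\<^sub>R expansion_term f z v N b)"
        by (auto intro!: sum.cong)
      also have "\<dots> = \<epsilon> ^ j *\<^sub>R expansion_coeff f z v j"
        unfolding scaleR_right.sum[symmetric]
        by (subst sum_expansion_terms_of_weight) (use j assms(5) in auto)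
      finally show "(\<Sum>b | b \<in> {b \<in> ?E. ?wt b < M} \<and> ?wt b = j. ?h \<epsilon> b) = \<epsilon> ^ j *\<^sub>R expansion_coeff f z v j" .
    qed
    finally show ?thesis .
  qed
  have high: "vanishes_to_order M (\<lambda>\<epsilon>. \<Sum>b | b \<in> ?E \<and> \<not> ?wt b < M. ?h \<epsilon> b)"
    by (rule vanishes_to_order_sum) (auto intro: vanishes_to_order_power)
  from vanishes_to_order_add[OF multivariate_expansion[OF assms(1,2,4,3), where N = N and v = v] this] show ?thesis
    unfolding split low by simp
qed

text \<open>
  The vector field along a polynomial curve, up to order \<open>l\<close>: multiplying the expansions of the
  single \<open>f\<^sub>i\<close> by \<open>\<epsilon>\<^sup>i\<close> and collecting the pairs \<open>(i, j)\<close> with \<open>i + j = n\<close>.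
\<close>

lemma field_expansion:
  fixes f :: "nat \<Rightarrow> 'a::euclidean_space \<Rightarrow> 'a"
  assumes "open D" "x \<in> D" "\<And>i. i \<in> {1..k} \<Longrightarrow> smooth_on D (f i)" "l \<le> k"
  shows "vanishes_to_order (Suc l) (\<lambda>\<epsilon>.
    (\<Sum>i = 1..k. \<epsilon> ^ i *\<^sub>R f i (x + (\<Sum>m = 1..k. (\<epsilon> ^ m / fact m) *\<^sub>R w m))) -
    (\<Sum>n = 1..l. \<epsilon> ^ n *\<^sub>R (\<Sum>j<n. expansion_coeff (f (n - j)) x w j)))"
proof -
  let ?W = "\<lambda>\<epsilon>. x + (\<Sum>m = 1..k. (\<epsilon> ^ m / fact m) *\<^sub>R w m)"
  define c where "c i j = expansion_coeff (f i) x w j" for i j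
  define P where "P = {1..k} \<times> {..<Suc l}"
  define h where "h \<epsilon> = (\<lambda>(i, j). \<epsilon> ^ (i + j) *\<^sub>R c i j)" for \<epsilon> :: real
  have [simp]: "finite P" by (simp add: P_def)
  have "vanishes_to_order (Suc l) (\<lambda>\<epsilon>. \<epsilon> ^ i *\<^sub>R (f i (?W \<epsilon>) - (\<Sum>j<Suc l. \<epsilon> ^ j *\<^sub>R c i j)))"
    if "i \<in> {1..k}" for i
    unfolding c_def using assms(4)
    by (intro vanishes_to_order_scaleR faa_di_bruno[OF assms(1,2) assms(3)[OF that]])
      (auto intro!: continuous_intros)
  then have "vanishes_to_order (Suc l) (\<lambda>\<epsilon>. \<Sum>i = 1..k. \<epsilon> ^ i *\<^sub>R (f i (?W \<epsilon>) - (\<Sum>j<Suc l. \<epsilon> ^ j *\<^sub>R c i j)))"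
    by (rule vanishes_to_order_sum)
  moreover have "vanishes_to_order (Suc l) (\<lambda>\<epsilon>. \<Sum>p | p \<in> P \<and> \<not> fst p + snd p \<le> l. h \<epsilon> p)"
    unfolding h_def case_prod_unfold by (rule vanishes_to_order_sum) (auto intro: vanishes_to_order_power)
  ultimately have main: "vanishes_to_order (Suc l) (\<lambda>\<epsilon>.
      (\<Sum>i = 1..k. \<epsilon> ^ i *\<^sub>R (f i (?W \<epsilon>) - (\<Sum>j<Suc l. \<epsilon> ^ j *\<^sub>R c i j))) +
      (\<Sum>p | p \<in> P \<and> \<not> fst p + snd p \<le> l. h \<epsilon> p))"
    by (rule vanishes_to_order_add)
  have double: "(\<Sum>i = 1..k. \<epsilon> ^ i *\<^sub>R (\<Sum>j<Suc l. \<epsilon> ^ j *\<^sub>R c i j)) = (\<Sum>p\<in>P. h \<epsilon> p)" for \<epsilon>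
    unfolding P_def h_def
    by (simp add: sum.cartesian_product[symmetric] scaleR_right.sum power_add del: sum.lessThan_Suc)
  have split: "(\<Sum>p\<in>P. h \<epsilon> p) = (\<Sum>p | p \<in> P \<and> fst p + snd p \<le> l. h \<epsilon> p) +
      (\<Sum>p | p \<in> P \<and> \<not> fst p + snd p \<le> l. h \<epsilon> p)" for \<epsilon>
  proof -
    have "P = {p. p \<in> P \<and> fst p + snd p \<le> l} \<union> {p. p \<in> P \<and> \<not> fst p + snd p \<le> l}" by blast
    then show ?thesis
      by (metis (no_types, lifting) \<open>finite P\<close> sum.union_disjoint finite_Un disjoint_iff mem_Collect_eq)
  qed
  have low: "(\<Sum>p | p \<in> P \<and> fst p + snd p \<le> l. h \<epsilon> p) = (\<Sum>n = 1..l. \<epsilon> ^ n *\<^sub>R (\<Sum>j<n. c (n - j) j))" for \<epsilon>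
  proof -
    have "(\<Sum>n = 1..l. \<epsilon> ^ n *\<^sub>R (\<Sum>j<n. c (n - j) j)) = (\<Sum>n = 1..l. \<Sum>j<n. \<epsilon> ^ n *\<^sub>R c (n - j) j)"
      by (simp add: scaleR_right.sum)
    also have "\<dots> = (\<Sum>(n, j)\<in>Sigma {1..l} (\<lambda>n. {..<n}). \<epsilon> ^ n *\<^sub>R c (n - j) j)"
      by (rule sum.Sigma) auto
    also have "\<dots> = (\<Sum>p | p \<in> P \<and> fst p + snd p \<le> l. h \<epsilon> p)"
      by (rule sum.reindex_bij_witness[of _ "\<lambda>(i, j). (i + j, j)" "\<lambda>(n, j). (n - j, j)"])
        (use assms(4) in \<open>auto simp: P_def h_def\<close>)
    finally show ?thesis by simp
  qed
  have "(\<Sum>i = 1..k. \<epsilon> ^ i *\<^sub>R (f i (?W \<epsilon>) - (\<Sum>j<Suc l. \<epsilon> ^ j *\<^sub>R c i j))) +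
      (\<Sum>p | p \<in> P \<and> \<not> fst p + snd p \<le> l. h \<epsilon> p) =
      (\<Sum>i = 1..k. \<epsilon> ^ i *\<^sub>R f i (?W \<epsilon>)) - (\<Sum>n = 1..l. \<epsilon> ^ n *\<^sub>R (\<Sum>j<n. c (n - j) j))" for \<epsilon>
    unfolding scaleR_diff_right sum_subtractf double split low by simp
  with main show ?thesis by (simp only: c_def)
qed

section \<open>Smoothness and periodicity of the Melnikov integrals\<close>

lemma expansion_coeff_cong_open:
  assumes "open S" "z \<in> S" "\<And>x. x \<in> S \<Longrightarrow> f x = g x" "\<And>l. 1 \<le> l \<Longrightarrow> l \<le> j \<Longrightarrow> v l = w l"
  shows "expansion_coeff f z v j = expansion_coeff g z w j"
proof -
  have "bell_apply f z j m v = bell_apply g z j m w" if "m \<in> {1..j}" for m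
  proof -
    have "bell_apply f z j m v = bell_apply g z j m v"
      unfolding bell_apply_def using frechet_iter_cong_open[OF assms(1,3,2)] by simp
    also have "\<dots> = bell_apply g z j m w"
      by (rule bell_apply_cong) (use assms(4) that in auto)
    finally show ?thesis .
  qed
  then show ?thesis
    unfolding expansion_coeff_def using assms(2,3) by simp
qed

lemma smooth_on_slice:
  assumes "smooth_on (UNIV \<times> D) (\<lambda>(t, x). f t x)"
  shows "smooth_on D (f t)"
proof -
  have "smooth_on D (\<lambda>x. (\<lambda>(t, x). f t x) (t, x))"
    by (rule smooth_on_compose[OF assms]) (auto intro: smooth_on_intros)
  then show ?thesis by simp
qed

lemma continuous_on_time_slice:
  assumes "smooth_on (UNIV \<times> D) (\<lambda>(t, x). f t x)" "x \<in> D"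
  shows "continuous_on UNIV (\<lambda>t. f t x)"
proof -
  have "continuous_on UNIV (\<lambda>t. (\<lambda>(t, x). f t x) (t, x))"
    by (rule continuous_on_compose2[OF smooth_on_imp_continuous_on[OF assms(1)]])
      (use assms(2) in \<open>auto intro!: continuous_intros\<close>)
  then show ?thesis by simp
qed

text \<open>
  By uniqueness of Taylor coefficients, \<open>faa_di_bruno\<close> identifies the Bell sum with an iterated
  \<open>\<epsilon>\<close>-derivative at \<open>\<epsilon> = 0\<close> of the function \<open>f (t, x + \<Sum> \<epsilon>\<^sup>m w\<^sub>m(t, x) / m!)\<close>, which is jointly smooth
  in \<open>(t, x, \<epsilon>)\<close> as a composition.
\<close>

lemma smooth_on_expansion_coeff:
  fixes f :: "real \<Rightarrow> 'a::euclidean_space \<Rightarrow> 'b::euclidean_space"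
  assumes "open D" and f: "smooth_on (UNIV \<times> D) (\<lambda>(t, x). f t x)"
    and w: "\<And>m. m \<in> {1..j} \<Longrightarrow> smooth_on (UNIV \<times> D) (\<lambda>(t, x). w m t x)"
  shows "smooth_on (UNIV \<times> D) (\<lambda>(t, x). expansion_coeff (f t) x (\<lambda>m. w m t x) j)"
proof -
  define W where "W = (\<lambda>(t, x, \<epsilon>). x + (\<Sum>m = 1..j. (\<epsilon> ^ m / fact m) *\<^sub>R w m t x))"
  define A where "A = (UNIV :: real set) \<times> D \<times> (UNIV :: real set)"
  have "open A" using assms(1) by (simp add: A_def open_Times)
  have w': "smooth_on A (\<lambda>q. w m (fst q) (fst (snd q)))" if "m \<in> {1..j}" for m
  proof -
    have "smooth_on A (\<lambda>q. (\<lambda>(t, x). w m t x) (fst q, fst (snd q)))"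
      by (rule smooth_on_compose[OF w[OF that]]) (auto simp: A_def intro!: smooth_on_intros)
    then show ?thesis by simp
  qed
  have "smooth_on A (\<lambda>q. fst (snd q) +
      (\<Sum>m = 1..j. (snd (snd q) ^ m * (1 / fact m)) *\<^sub>R w m (fst q) (fst (snd q))))"
    by (intro smooth_on_intros w')
  then have W: "smooth_on A W"
    by (simp add: W_def case_prod_unfold)
  define B where "B = A \<inter> W -` D"
  have "open B"
    unfolding B_def using smooth_on_imp_continuous_on[OF W] \<open>open A\<close> assms(1)
    by (rule continuous_open_preimage)
  define G where "G q = f (fst q) (W q)" for q
  have "smooth_on B (\<lambda>q. (\<lambda>(t, x). f t x) (fst q, W q))"
    by (rule smooth_on_compose[OF f])
      (auto simp: B_def intro!: smooth_on_intros intro: smooth_on_subset[OF W])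
  then have G: "smooth_on B G" by (simp add: G_def[abs_def])
  have W0: "W (t, x, 0) = x" for t x
  proof -
    have "(\<Sum>m = 1..j. ((0::real) ^ m / fact m) *\<^sub>R w m t x) = 0"
      by (rule sum.neutral) (auto simp: power_0_left)
    then show ?thesis by (simp add: W_def)
  qed
  then have mem: "(t, x, 0) \<in> B" if "x \<in> D" for t x
    using that by (simp add: B_def A_def)
  let ?d = "replicate j (0, 0, 1)"
  have "smooth_on (UNIV \<times> D) (\<lambda>p. frechet_iter G ?d (fst p, snd p, 0))"
    by (rule smooth_on_compose[OF smooth_on_frechet_iter[OF \<open>open B\<close> G]])
      (auto intro!: smooth_on_intros simp: mem)
  then have *: "smooth_on (UNIV \<times> D) (\<lambda>p. (1 / fact j) *\<^sub>R frechet_iter G ?d (fst p, snd p, 0))"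
    by (intro smooth_on_intros)
  have "(1 / fact j) *\<^sub>R frechet_iter G ?d (t, x, 0) = expansion_coeff (f t) x (\<lambda>m. w m t x) j"
    if "x \<in> D" for t x
  proof (rule taylor_coefficients_unique)
    have "G ((t, x, 0) + \<epsilon> *\<^sub>R (0, 0, 1)) = f t (x + (\<Sum>m = 1..j. (\<epsilon> ^ m / fact m) *\<^sub>R w m t x))" for \<epsilon>
      by (simp add: G_def W_def)
    then show "vanishes_to_order (Suc j) (\<lambda>\<epsilon>. f t (x + (\<Sum>m = 1..j. (\<epsilon> ^ m / fact m) *\<^sub>R w m t x)) -
        (\<Sum>i<Suc j. \<epsilon> ^ i *\<^sub>R ((1 / fact i) *\<^sub>R frechet_iter G (replicate i (0, 0, 1)) (t, x, 0))))"
      using taylor_expansion[OF \<open>open B\<close> mem[OF that, of t] G, where v = "(0, 0, 1)" and M = "Suc j"]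
      by (simp del: sum.lessThan_Suc)
    show "vanishes_to_order (Suc j) (\<lambda>\<epsilon>. f t (x + (\<Sum>m = 1..j. (\<epsilon> ^ m / fact m) *\<^sub>R w m t x)) -
        (\<Sum>i<Suc j. \<epsilon> ^ i *\<^sub>R expansion_coeff (f t) x (\<lambda>m. w m t x) i))"
      by (rule faa_di_bruno[OF assms(1) that smooth_on_slice[OF f]]) auto
  qed simp
  then have "(1 / fact j) *\<^sub>R frechet_iter G ?d (fst p, snd p, 0) =
      (\<lambda>(t, x). expansion_coeff (f t) x (\<lambda>m. w m t x) j) p" if "p \<in> UNIV \<times> D" for p
    using that by (auto simp: case_prod_unfold)
  from smooth_on_cong[THEN iffD1, OF this *] show ?thesis .
qed

lemma interval_integral_has_vector_derivative:
  fixes g :: "real \<Rightarrow> 'b::euclidean_space"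
  assumes "continuous_on UNIV g"
  shows "((\<lambda>t. LBINT s=0..ereal t. g s) has_vector_derivative g t) (at t)"
proof -
  let ?a = "min 0 t - 1" and ?b = "max 0 t + 1"
  have "((\<lambda>t. LBINT s=ereal 0..ereal t. g s) has_vector_derivative g t) (at t within {?a..?b})"
    by (rule interval_integral_FTC2) (auto intro: continuous_on_subset[OF assms])
  moreover have "at t within {?a..?b} = at t"
    by (rule at_within_interior) (auto simp: interior_atLeastAtMost_real)
  ultimately show ?thesis by (simp flip: zero_ereal_def)
qed

text \<open>
  Substituting \<open>s = t \<sigma>\<close> moves the moving bound of integration into the integrand, so that smooth
  dependence on parameters applies.
\<close>

lemma smooth_on_interval_integral:
  fixes g :: "real \<Rightarrow> 'a::euclidean_space \<Rightarrow> 'b::euclidean_space"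
  assumes "open D" and g: "smooth_on (UNIV \<times> D) (\<lambda>(t, x). g t x)"
  shows "smooth_on (UNIV \<times> D) (\<lambda>(t, x). LBINT s=0..ereal t. g s x)"
proof -
  have "smooth_on ((UNIV \<times> D) \<times> {0..1}) (\<lambda>q. (\<lambda>(t, x). g t x) (snd q * fst (fst q), snd (fst q)))"
    by (rule smooth_on_compose[OF g]) (auto intro!: smooth_on_intros)
  then have "smooth_on ((UNIV \<times> D) \<times> {0..1}) (\<lambda>q. fst (fst q) *\<^sub>R g (snd q * fst (fst q)) (snd (fst q)))"
    by (intro smooth_on_intros) auto
  from smooth_on_integral[OF _ this] assms(1)
  have *: "smooth_on (UNIV \<times> D) (\<lambda>p. integral {0..1} (\<lambda>s. fst p *\<^sub>R g (s * fst p) (snd p)))"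
    by (simp add: open_Times)
  have "integral {0..1} (\<lambda>s. t *\<^sub>R g (s * t) x) = (LBINT s=0..ereal t. g s x)" if "x \<in> D" for t x
  proof -
    note d = interval_integral_has_vector_derivative[OF continuous_on_time_slice[OF g that]]
    have "((\<lambda>s. LBINT s=0..ereal (s * t). g s x) has_vector_derivative t *\<^sub>R g (s * t) x) (at s within {0..1})" for s
    proof -
      have "((\<lambda>s. s * t) has_vector_derivative t) (at s within {0..1})"
        by (auto intro!: derivative_eq_intros)
      from vector_diff_chain_within[OF this has_vector_derivative_at_within[OF d]]
      show ?thesis by (simp add: o_def)
    qed
    then have "((\<lambda>s. t *\<^sub>R g (s * t) x) has_integral
        ((LBINT s=0..ereal (1 * t). g s x) - (LBINT s=0..ereal (0 * t). g s x))) {0..1}"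
      by (intro fundamental_theorem_of_calculus) auto
    from integral_unique[OF this] show ?thesis by (simp flip: zero_ereal_def)
  qed
  then have "integral {0..1} (\<lambda>s. fst p *\<^sub>R g (s * fst p) (snd p)) = (\<lambda>(t, x). LBINT s=0..ereal t. g s x) p"
    if "p \<in> UNIV \<times> D" for p
    using that by (auto simp: case_prod_unfold)
  from smooth_on_cong[THEN iffD1, OF this *] show ?thesis .
qed

text \<open>
  The integrand in the definition of \<open>melnikov_y\<close>, regrouped: with the term \<open>F\<^sub>n\<close> as the summand
  \<open>j = 0\<close>, it is \<open>n!\<close> times the coefficient of \<open>\<epsilon>\<^sup>n\<close> in the vector field along
  \<open>z + \<Sum> \<epsilon>\<^sup>m y\<^sub>m / m!\<close>.
\<close>

definition melnikov_rate ::
  "(nat \<Rightarrow> real \<Rightarrow> (real ^ 'n) \<Rightarrow> real ^ 'n) \<Rightarrow> nat \<Rightarrow> real \<Rightarrow> real ^ 'n \<Rightarrow> real ^ 'n" where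
  "melnikov_rate F n t z =
     fact n *\<^sub>R (\<Sum>j<n. expansion_coeff (F (n - j) t) z (\<lambda>l. melnikov_y F l t z) j)"

lemma melnikov_y_eq_integral:
  assumes "1 \<le> n"
  shows "melnikov_y F n t z = (LBINT s=0..ereal t. melnikov_rate F n s z)"
proof -
  have "{..<n} = insert 0 {1..n - 1}"
    using assms by auto
  then have "fact n *\<^sub>R F n s z + (\<Sum>j = 1..n - 1. \<Sum>m = 1..j. (fact n / fact j) *\<^sub>R
        bell_apply (F (n - j) s) z j m (\<lambda>l. melnikov_y F l s z)) = melnikov_rate F n s z" for s
    by (simp add: melnikov_rate_def expansion_coeff_def scaleR_add_right scaleR_right.sum)
  then show ?thesis
    by (subst melnikov_y.simps) simp
qed

lemma melnikov_y_0:
  assumes "1 \<le> n"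
  shows "melnikov_y F n 0 z = 0"
  unfolding melnikov_y_eq_integral[OF assms] by (simp flip: zero_ereal_def)

lemma
  assumes "open D" and F: "\<And>i. i \<in> {1..k} \<Longrightarrow> smooth_on (UNIV \<times> D) (\<lambda>(t, x). F i t x)"
  shows smooth_on_melnikov_y: "n \<in> {1..k} \<Longrightarrow> smooth_on (UNIV \<times> D) (\<lambda>(t, x). melnikov_y F n t x)"
    and smooth_on_melnikov_rate: "n \<in> {1..k} \<Longrightarrow> smooth_on (UNIV \<times> D) (\<lambda>(t, x). melnikov_rate F n t x)"
proof -
  have rate: "smooth_on (UNIV \<times> D) (\<lambda>(t, x). melnikov_rate F n t x)"
    if "n \<in> {1..k}" and y: "\<And>m. m \<in> {1..<n} \<Longrightarrow> smooth_on (UNIV \<times> D) (\<lambda>(t, x). melnikov_y F m t x)" for n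
  proof -
    have "smooth_on (UNIV \<times> D) (\<lambda>(t, x). expansion_coeff (F (n - j) t) x (\<lambda>l. melnikov_y F l t x) j)"
      if "j \<in> {..<n}" for j
      using that \<open>n \<in> {1..k}\<close> by (intro smooth_on_expansion_coeff assms y) auto
    then have "smooth_on (UNIV \<times> D) (\<lambda>p. fact n *\<^sub>R (\<Sum>j<n.
        (\<lambda>(t, x). expansion_coeff (F (n - j) t) x (\<lambda>l. melnikov_y F l t x) j) p))"
      by (intro smooth_on_scaleR smooth_on_sum smooth_on_const)
    then show ?thesis by (simp add: melnikov_rate_def case_prod_unfold)
  qed
  have y: "smooth_on (UNIV \<times> D) (\<lambda>(t, x). melnikov_y F n t x)" if "n \<in> {1..k}" for n
    using that
  proof (induction n rule: less_induct)
    case (less n)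
    then have "smooth_on (UNIV \<times> D) (\<lambda>(t, x). melnikov_rate F n t x)"
      by (intro rate) auto
    from smooth_on_interval_integral[OF assms(1) this] less.prems show ?case
      by (simp add: melnikov_y_eq_integral)
  qed
  then show "n \<in> {1..k} \<Longrightarrow> smooth_on (UNIV \<times> D) (\<lambda>(t, x). melnikov_y F n t x)" .
  from rate y show "n \<in> {1..k} \<Longrightarrow> smooth_on (UNIV \<times> D) (\<lambda>(t, x). melnikov_rate F n t x)"
    by auto
qed

lemma melnikov_y_has_vector_derivative:
  assumes "open D" and F: "\<And>i. i \<in> {1..k} \<Longrightarrow> smooth_on (UNIV \<times> D) (\<lambda>(t, x). F i t x)"
    and "n \<in> {1..k}" "z \<in> D"
  shows "((\<lambda>t. melnikov_y F n t z) has_vector_derivative melnikov_rate F n t z) (at t)"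
proof -
  have "continuous_on UNIV (\<lambda>t. melnikov_rate F n t z)"
    using smooth_on_melnikov_rate[where F = F, OF assms(1-3)] assms(4) by (rule continuous_on_time_slice)
  from interval_integral_has_vector_derivative[OF this] show ?thesis
    using assms(3) by (simp add: melnikov_y_eq_integral)
qed

lemma melnikov_rate_periodic:
  assumes "open D" "z \<in> D" "\<And>i x. i \<in> {1..k} \<Longrightarrow> x \<in> D \<Longrightarrow> F i (t + T) x = F i t x" "n \<le> k"
    and "\<And>m. m \<in> {1..<n} \<Longrightarrow> melnikov_y F m (t + T) z = melnikov_y F m t z"
  shows "melnikov_rate F n (t + T) z = melnikov_rate F n t z"
proof -
  have "expansion_coeff (F (n - j) (t + T)) z (\<lambda>l. melnikov_y F l (t + T) z) j =
      expansion_coeff (F (n - j) t) z (\<lambda>l. melnikov_y F l t z) j" if "j \<in> {..<n}" for j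
  proof (rule expansion_coeff_cong_open[OF assms(1,2)])
    have "n - j \<in> {1..k}" using that assms(4) by auto
    then show "F (n - j) (t + T) x = F (n - j) t x" if "x \<in> D" for x
      using assms(3) that by blast
  qed (use that assms(5) in auto)
  then show ?thesis unfolding melnikov_rate_def by simp
qed

text \<open>
  The primitive of a periodic function grows over each period by the integral over one period.
\<close>

lemma melnikov_y_add_period:
  assumes "open D" and F: "\<And>i. i \<in> {1..k} \<Longrightarrow> smooth_on (UNIV \<times> D) (\<lambda>(t, x). F i t x)"
    and "n \<in> {1..k}" "z \<in> D" and per: "\<And>t. melnikov_rate F n (t + T) z = melnikov_rate F n t z"
  shows "melnikov_y F n (t + T) z = melnikov_y F n t z + melnikov_y F n T z"
proof -
  note d = melnikov_y_has_vector_derivative[where F = F, OF assms(1-4)]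
  have "((\<lambda>t. melnikov_y F n (t + T) z) has_vector_derivative melnikov_rate F n t z) (at t)" for t
  proof -
    have "((\<lambda>t. t + T) has_vector_derivative 1) (at t)"
      by (auto intro!: derivative_eq_intros)
    from vector_diff_chain_at[OF this d] show ?thesis by (simp add: o_def per)
  qed
  from has_vector_derivative_diff[OF this d]
  have "((\<lambda>t. melnikov_y F n (t + T) z - melnikov_y F n t z) has_vector_derivative 0) (at t)" for t
    by simp
  then obtain c where c: "melnikov_y F n (t + T) z - melnikov_y F n t z = c" for t
    using has_vector_derivative_zero_constant[of UNIV "\<lambda>t. melnikov_y F n (t + T) z - melnikov_y F n t z"]
    by auto
  from c[of 0] have "c = melnikov_y F n T z"
    using assms(3) by (simp add: melnikov_y_0)
  with c[of t] show ?thesis by (simp add: algebra_simps)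
qed

lemma melnikov_y_periodic:
  assumes "open D" and F: "\<And>i. i \<in> {1..k} \<Longrightarrow> smooth_on (UNIV \<times> D) (\<lambda>(t, x). F i t x)"
    and per: "\<And>i t x. i \<in> {1..k} \<Longrightarrow> x \<in> D \<Longrightarrow> F i (t + T) x = F i t x"
    and "l \<le> k" "z \<in> D" and zero: "\<And>i. i < l \<Longrightarrow> melnikov F T i z = 0"
  shows "n \<in> {1..<l} \<Longrightarrow> melnikov_y F n (t + T) z = melnikov_y F n t z"
proof (induction n arbitrary: t rule: less_induct)
  case (less n)
  then have "melnikov_rate F n (t + T) z = melnikov_rate F n t z" for t
    using assms by (intro melnikov_rate_periodic[of D z k]) auto
  with less.prems assms have "melnikov_y F n (t + T) z = melnikov_y F n t z + melnikov_y F n T z"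
    by (intro melnikov_y_add_period[of D k]) auto
  moreover have "melnikov_y F n T z = 0"
    using zero[of n] less.prems by (simp add: melnikov_def)
  ultimately show ?case by simp
qed

section \<open>Division by a power of the parameter, linear systems, periodic tubes\<close>

text \<open>
  Hadamard's lemma. The hypothesis is pointwise in \<open>(t, x)\<close>, the conclusion is jointly smooth: it makes
  all Taylor coefficients in \<open>\<epsilon>\<close> vanish, and what is left is the integral remainder. The
  set \<open>S\<close> has to be star-shaped in \<open>\<epsilon>\<close> because the remainder integrates over the segment from
  \<open>(t, x, 0)\<close> to \<open>(t, x, \<epsilon>)\<close>.
\<close>

lemma smooth_division:
  fixes \<Phi> :: "real \<times> 'a::euclidean_space \<times> real \<Rightarrow> 'b::euclidean_space"
  assumes "open S" and \<Phi>: "smooth_on S \<Phi>" and "M > 0"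
    and star: "\<And>t x \<epsilon> s. (t, x, \<epsilon>) \<in> S \<Longrightarrow> s \<in> {0..1} \<Longrightarrow> (t, x, s * \<epsilon>) \<in> S"
    and van: "\<And>t x. (t, x, 0) \<in> S \<Longrightarrow> vanishes_to_order M (\<lambda>\<epsilon>. \<Phi> (t, x, \<epsilon>))"
  obtains H where "smooth_on S H" "\<And>t x \<epsilon>. (t, x, \<epsilon>) \<in> S \<Longrightarrow> \<Phi> (t, x, \<epsilon>) = \<epsilon> ^ M *\<^sub>R H (t, x, \<epsilon>)"
proof
  let ?e = "(0, 0, 1) :: real \<times> 'a \<times> real"
  define H where "H q = integral {0..1} (\<lambda>s. ((1 - s) ^ (M - 1) * (1 / fact (M - 1))) *\<^sub>R
      frechet_iter \<Phi> (replicate M ?e) (fst q, fst (snd q), s * snd (snd q)))" for q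
  have "smooth_on (S \<times> {0..1}) (\<lambda>p. ((1 - snd p) ^ (M - 1) * (1 / fact (M - 1))) *\<^sub>R
      frechet_iter \<Phi> (replicate M ?e) (fst (fst p), fst (snd (fst p)), snd p * snd (snd (fst p))))"
    by (intro smooth_on_intros smooth_on_compose[OF smooth_on_frechet_iter[OF assms(1) \<Phi>]])
      (use star in auto)
  from smooth_on_integral[OF assms(1) this] show "smooth_on S H"
    by (simp add: H_def[abs_def])
  fix t x \<epsilon> assume q: "(t, x, \<epsilon>) \<in> S"
  from star[OF q, of 0] have q0: "(t, x, 0) \<in> S" by simp
  have coeff: "(1 / fact j) *\<^sub>R frechet_iter \<Phi> (replicate j ?e) (t, x, 0) = 0" if "j < M" for j
  proof (rule taylor_coefficients_unique[OF _ _ that])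
    show "vanishes_to_order M (\<lambda>\<epsilon>. \<Phi> (t, x, \<epsilon>) - (\<Sum>j<M. \<epsilon> ^ j *\<^sub>R
        ((1 / fact j) *\<^sub>R frechet_iter \<Phi> (replicate j ?e) (t, x, 0))))"
      using taylor_expansion[OF assms(1) q0 \<Phi> \<open>M > 0\<close>, of ?e] by simp
    show "vanishes_to_order M (\<lambda>\<epsilon>. \<Phi> (t, x, \<epsilon>) - (\<Sum>j<M. \<epsilon> ^ j *\<^sub>R 0))"
      using van[OF q0] by simp
  qed
  have "\<Phi> ((t, x, 0) + \<epsilon> *\<^sub>R ?e) =
    (\<Sum>j<M. (\<epsilon> ^ j / fact j) *\<^sub>R frechet_iter \<Phi> (replicate j ?e) (t, x, 0)) +
    \<epsilon> ^ M *\<^sub>R integral {0..1} (\<lambda>s. ((1 - s) ^ (M - 1) / fact (M - 1)) *\<^sub>R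
      frechet_iter \<Phi> (replicate M ?e) ((t, x, 0) + (s * \<epsilon>) *\<^sub>R ?e))"
    by (rule taylor_line[OF assms(1) \<Phi> _ \<open>M > 0\<close>]) (use star[OF q] in simp)
  moreover have "(\<Sum>j<M. (\<epsilon> ^ j / fact j) *\<^sub>R frechet_iter \<Phi> (replicate j ?e) (t, x, 0)) = 0"
    using coeff by (intro sum.neutral) auto
  ultimately show "\<Phi> (t, x, \<epsilon>) = \<epsilon> ^ M *\<^sub>R H (t, x, \<epsilon>)"
    by (simp add: H_def)
qed

text \<open>
  An explicit formula for \<open>A\<^sup>-\<^sup>1 b\<close> that is visibly smooth in the entries of \<open>A\<close> and \<open>b\<close>.
\<close>

definition cramer_solution :: "real ^ 'n ^ 'n \<Rightarrow> real ^ 'n \<Rightarrow> real ^ 'n" where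
  "cramer_solution A b = (\<chi> k. det (\<chi> i j. if j = k then b $ i else A $ i $ j) / det A)"

lemma cramer_solution: "det A \<noteq> 0 \<Longrightarrow> A *v cramer_solution A b = b"
  unfolding cramer_solution_def by (subst cramer) simp_all

lemma smooth_on_cramer_solution:
  fixes A :: "'a::euclidean_space \<Rightarrow> real ^ 'n ^ 'n"
  assumes A: "\<And>i j. smooth_on S (\<lambda>q. A q $ i $ j)" and b: "smooth_on S b"
    and "\<And>q. q \<in> S \<Longrightarrow> det (A q) \<noteq> 0"
  shows "smooth_on S (\<lambda>q. cramer_solution (A q) (b q))"
proof -
  have "smooth_on S (\<lambda>q. (\<chi> i j. if j = k then b q $ i else A q $ i $ j) $ i' $ j')" for k i' j'
    using A smooth_on_vec_nth[OF b] by (cases "j' = k") simp_all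
  then show ?thesis
    unfolding cramer_solution_def
    by (intro smooth_on_vec_lambda smooth_on_divide smooth_on_det assms)
qed

lemma periodic_predicate:
  fixes T :: real
  assumes "T > 0" "\<And>t. P (t + T) \<longleftrightarrow> P t" "\<And>t. t \<in> {0..T} \<Longrightarrow> P t"
  shows "P t"
proof -
  have step: "P (s + real n * T) \<longleftrightarrow> P s" for s n
  proof (induction n)
    case (Suc n)
    then show ?case using assms(2)[of "s + real n * T"] by (simp add: algebra_simps)
  qed simp
  define m where "m = \<lfloor>t / T\<rfloor>"
  have "of_int m \<le> t / T" "t / T < of_int m + 1"
    unfolding m_def by linarith+
  then have m: "P (t - of_int m * T)"
    using \<open>T > 0\<close> by (intro assms(3)) (auto simp: field_simps)
  show ?thesis
  proof (cases "m \<ge> 0")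
    case True
    then show ?thesis using step[of "t - of_int m * T" "nat m"] m by simp
  next
    case False
    then show ?thesis using step[of t "nat (- m)"] m by simp
  qed
qed

text \<open>
  The tube lemma over the compact set \<open>[0, T] \<times> K\<close>, extended to all times by periodicity.
\<close>

lemma periodic_tube:
  fixes A :: "(real \<times> 'a::euclidean_space \<times> real) set"
  assumes "open A" "compact K" "T > 0"
    and "\<And>t x. x \<in> K \<Longrightarrow> (t, x, 0) \<in> A"
    and "\<And>t x \<epsilon>. (t + T, x, \<epsilon>) \<in> A \<longleftrightarrow> (t, x, \<epsilon>) \<in> A"
  shows "\<exists>e>0. \<forall>t. \<forall>x\<in>K. \<forall>\<epsilon>. \<bar>\<epsilon>\<bar> < e \<longrightarrow> (t, x, \<epsilon>) \<in> A"
proof -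
  define W where "W = (\<lambda>p :: real \<times> real \<times> 'a. (fst (snd p), snd (snd p), fst p)) -` A"
  have "open W"
    unfolding W_def using assms(1) by (intro open_vimage continuous_intros)
  have "compact ({0..T} \<times> K)"
    using assms(2) by (intro compact_Times) auto
  have sub: "{0} \<times> {0..T} \<times> K \<subseteq> W"
    using assms(4) by (auto simp: W_def)
  obtain X where X: "0 \<in> X" "open X" "X \<times> {0..T} \<times> K \<subseteq> W"
    using Elementary_Topology.tube_lemma[OF \<open>compact ({0..T} \<times> K)\<close> \<open>open W\<close> sub] by auto
  then obtain e where e: "e > 0" "ball 0 e \<subseteq> X"
    using open_contains_ball by blast
  have "(t, x, \<epsilon>) \<in> A" if "x \<in> K" "\<bar>\<epsilon>\<bar> < e" for t x \<epsilon>
  proof (rule periodic_predicate[where P = "\<lambda>t. (t, x, \<epsilon>) \<in> A", OF \<open>T > 0\<close>])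
    show "(t + T, x, \<epsilon>) \<in> A \<longleftrightarrow> (t, x, \<epsilon>) \<in> A" for t by (rule assms(5))
    fix t assume "t \<in> {0..T}"
    moreover have "\<epsilon> \<in> X" using e(2) that(2) by auto
    ultimately have "(\<epsilon>, t, x) \<in> W" using X(3) that(1) by blast
    then show "(t, x, \<epsilon>) \<in> A" by (simp add: W_def)
  qed
  with e(1) show ?thesis by blast
qed

section \<open>The near-identity transformation\<close>

text \<open>
  The general mechanism behind the theorem: a periodic solution \<open>u\<close> of the equations up to order \<open>l\<close>,
  expressed by the hypothesis \<open>homological\<close>, brings the system to the form
  \<open>\<epsilon>\<^sup>l v(\<xi>) + \<epsilon>\<^bsup>l+1\<^esup> r(t, \<xi>, \<epsilon>)\<close>. With \<open>J = \<partial>\<^sub>\<xi> U\<close>, the remainder has to satisfy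
  \<open>\<epsilon>\<^bsup>l+1\<^esup> J r = \<Phi>\<close> for \<open>\<Phi> = X(t, U, \<epsilon>) - \<partial>\<^sub>t U - \<epsilon>\<^sup>l J v\<close>. Since \<open>J\<close> differs from the identity by
  terms of order \<open>\<epsilon>\<close>, \<open>\<Phi>\<close> vanishes to order \<open>l + 1\<close>, and \<open>smooth_division\<close> yields a smooth \<open>J r\<close>.
\<close>

lemma near_identity_normal_form:
  fixes D :: "(real ^ 'n) set"
    and F u du :: "nat \<Rightarrow> real \<Rightarrow> real ^ 'n \<Rightarrow> real ^ 'n"
    and R :: "real \<Rightarrow> real ^ 'n \<Rightarrow> real \<Rightarrow> real ^ 'n"
    and v :: "real ^ 'n \<Rightarrow> real ^ 'n"
    and T \<epsilon>0 :: real
    and k l :: nat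
  defines "X \<equiv> \<lambda>t x \<epsilon>. (\<Sum>i = 1..k. \<epsilon> ^ i *\<^sub>R F i t x) + \<epsilon> ^ (k + 1) *\<^sub>R R t x \<epsilon>"
  assumes "open D" "T > 0" "\<epsilon>0 > 0" "l \<le> k"
    and F: "\<And>i. i \<in> {1..k} \<Longrightarrow> smooth_on (UNIV \<times> D) (\<lambda>(t, x). F i t x)"
    and F_per: "\<And>i t x. i \<in> {1..k} \<Longrightarrow> x \<in> D \<Longrightarrow> F i (t + T) x = F i t x"
    and R: "smooth_on (UNIV \<times> D \<times> {-\<epsilon>0..\<epsilon>0}) (\<lambda>(t, x, \<epsilon>). R t x \<epsilon>)"
    and R_per: "\<And>t x \<epsilon>. x \<in> D \<Longrightarrow> \<epsilon> \<in> {-\<epsilon>0..\<epsilon>0} \<Longrightarrow> R (t + T) x \<epsilon> = R t x \<epsilon>"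
    and u: "\<And>i. i \<in> {1..k} \<Longrightarrow> smooth_on (UNIV \<times> D) (\<lambda>(t, x). u i t x)"
    and u_per: "\<And>i t x. i \<in> {1..k} \<Longrightarrow> x \<in> D \<Longrightarrow> u i (t + T) x = u i t x"
    and du: "\<And>i. i \<in> {1..k} \<Longrightarrow> smooth_on (UNIV \<times> D) (\<lambda>(t, x). du i t x)"
    and du_per: "\<And>i t x. i \<in> {1..k} \<Longrightarrow> x \<in> D \<Longrightarrow> du i (t + T) x = du i t x"
    and u_du: "\<And>i t x. i \<in> {1..k} \<Longrightarrow> x \<in> D \<Longrightarrow>
      ((\<lambda>t. u i t x) has_vector_derivative du i t x) (at t)"
    and v: "smooth_on D v"
    and homological: "\<And>t x. x \<in> D \<Longrightarrow> vanishes_to_order (Suc l) (\<lambda>\<epsilon>.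
      (\<Sum>i = 1..k. \<epsilon> ^ i *\<^sub>R F i t (near_identity k u t x \<epsilon>)) -
      (\<Sum>i = 1..k. \<epsilon> ^ i *\<^sub>R du i t x) - \<epsilon> ^ l *\<^sub>R v x)"
  shows "\<exists>r. \<forall>V. open V \<and> compact (closure V) \<and> closure V \<subseteq> D \<longrightarrow>
      (\<exists>\<epsilon>V. 0 < \<epsilon>V \<and> \<epsilon>V \<le> \<epsilon>0 \<and>
        smooth_on (UNIV \<times> V \<times> {-\<epsilon>V..\<epsilon>V}) (\<lambda>(t, \<xi>, \<epsilon>). r t \<xi> \<epsilon>) \<and>
        (\<forall>t. \<forall>\<xi>\<in>V. \<forall>\<epsilon>\<in>{-\<epsilon>V..\<epsilon>V}.
          near_identity k u t \<xi> \<epsilon> \<in> D \<and>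
          r (t + T) \<xi> \<epsilon> = r t \<xi> \<epsilon> \<and>
          transforms_at (near_identity k u) X
            (\<lambda>t \<xi> \<epsilon>. \<epsilon> ^ l *\<^sub>R v \<xi> + \<epsilon> ^ (l + 1) *\<^sub>R r t \<xi> \<epsilon>) t \<xi> \<epsilon>))"
proof -
  define A where "A = (UNIV :: real set) \<times> D \<times> (UNIV :: real set)"
  have "open A" using \<open>open D\<close> by (simp add: A_def open_Times)
  have A_iff: "(t, x, \<epsilon>) \<in> A \<longleftrightarrow> x \<in> D" for t x \<epsilon> by (simp add: A_def)
  define U where "U q = near_identity k u (fst q) (fst (snd q)) (snd (snd q))" for q
  have U_eq: "U (t, x, \<epsilon>) = near_identity k u t x \<epsilon>" for t x \<epsilon> by (simp add: U_def)
  define dU where "dU q = (\<Sum>i = 1..k. snd (snd q) ^ i *\<^sub>R du i (fst q) (fst (snd q)))"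
    for q :: "real \<times> (real ^ 'n) \<times> real"
  have lift: "smooth_on A (\<lambda>q. g (fst q) (fst (snd q)))" if "smooth_on (UNIV \<times> D) (\<lambda>(t, x). g t x)"
    for g :: "real \<Rightarrow> real ^ 'n \<Rightarrow> real ^ 'n"
  proof -
    have "smooth_on A (\<lambda>q. (\<lambda>(t, x). g t x) (fst q, fst (snd q)))"
      by (rule smooth_on_compose[OF that]) (auto simp: A_def intro!: smooth_on_intros)
    then show ?thesis by simp
  qed
  have U: "smooth_on A U"
    unfolding U_def[abs_def] near_identity_def by (intro smooth_on_intros lift u)
  have dU: "smooth_on A dU"
    unfolding dU_def[abs_def] by (intro smooth_on_intros lift du)
  have U0: "U (t, x, 0) = x" for t x
  proof -
    have "(\<Sum>i = 1..k. (0::real) ^ i *\<^sub>R u i t x) = 0"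
      by (rule sum.neutral) (auto simp: power_0_left)
    then show ?thesis by (simp add: U_def near_identity_def)
  qed
  have U_per: "U (t + T, x, \<epsilon>) = U (t, x, \<epsilon>)" if "x \<in> D" for t x \<epsilon>
    using u_per that by (simp add: U_def near_identity_def)

  define J where "J q = matrix (\<lambda>h. frechet_derivative U (at q) (0, h, 0))" for q
  have J_entry: "smooth_on A (\<lambda>q. J q $ i $ j)" for i j
    unfolding J_def matrix_def
    using smooth_on_vec_nth[OF smooth_on_frechet_derivative_const[OF \<open>open A\<close> U, of "(0, axis j 1, 0)"], of i]
    by simp
  have J_apply: "J q *v h = frechet_derivative U (at q) (0, h, 0)" if "q \<in> A" for q h
  proof -
    have "linear (frechet_derivative U (at q))"
      using smooth_on_has_derivative[OF \<open>open A\<close> U that] by (rule has_derivative_linear)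
    moreover have "linear (\<lambda>h :: real ^ 'n. (0::real, h, 0::real))"
      by (auto intro!: linearI)
    ultimately have "linear (\<lambda>h. frechet_derivative U (at q) (0, h, 0))"
      using linear_compose[of "\<lambda>h. (0, h, 0)" "frechet_derivative U (at q)"] by (simp add: o_def)
    then show ?thesis
      unfolding J_def by (simp add: matrix_works linear_matrix_vector_mul_eq)
  qed
  have U_space: "((\<lambda>x. near_identity k u t x \<epsilon>) has_derivative (\<lambda>h. J (t, x, \<epsilon>) *v h)) (at x)"
    if "x \<in> D" for t x \<epsilon>
  proof -
    have q: "(t, x, \<epsilon>) \<in> A" using that by (simp add: A_iff)
    have "((\<lambda>x. (t, x, \<epsilon>)) has_derivative (\<lambda>h. (0, h, 0))) (at x)"
      by (auto intro!: derivative_eq_intros)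
    from has_derivative_compose[OF this smooth_on_has_derivative[OF \<open>open A\<close> U q]]
    show ?thesis using J_apply[OF q] by (simp add: U_eq)
  qed
  have J0: "J (t, x, 0) *v h = h" if "x \<in> D" for t x h
  proof -
    have "((\<lambda>x. x) has_derivative (\<lambda>h. J (t, x, 0) *v h)) (at x)"
      using U_space[OF that, of t 0] U0[of t] by (simp add: U_eq)
    from has_derivative_unique[OF this has_derivative_ident] show ?thesis by metis
  qed
  have det_J0: "det (J (t, x, 0)) = 1" if "x \<in> D" for t x
  proof -
    have "J (t, x, 0) = mat 1"
      by (simp add: matrix_eq J0[OF that] matrix_vector_mul_lid)
    then show ?thesis by simp
  qed
  have J_per: "J (t + T, x, \<epsilon>) = J (t, x, \<epsilon>)" if "x \<in> D" for t x \<epsilon>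
  proof -
    have "((\<lambda>x. near_identity k u t x \<epsilon>) has_derivative (\<lambda>h. J (t + T, x, \<epsilon>) *v h)) (at x)"
      by (rule has_derivative_transform_within_open[OF U_space[OF that] \<open>open D\<close> that])
        (use U_per in \<open>simp add: U_eq\<close>)
    from has_derivative_unique[OF this U_space[OF that]] show ?thesis
      by (simp add: matrix_eq fun_eq_iff)
  qed

  \<comment> \<open>On the union \<open>\<Omega>\<close> of all admissible tubes \<open>\<real> \<times> V \<times> (-e, e)\<close> the transformation is defined and
    its space derivative invertible. Being open, star-shaped in \<open>\<epsilon>\<close> and independent of \<open>V\<close>, it allows
    to construct \<open>r\<close> once for all \<open>V\<close>.\<close>
  define tube where "tube V e \<longleftrightarrow> open V \<and> V \<subseteq> D \<and> 0 < e \<and> e \<le> \<epsilon>0 \<and>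
    (\<forall>t. \<forall>x\<in>V. \<forall>\<epsilon>. \<bar>\<epsilon>\<bar> < e \<longrightarrow> U (t, x, \<epsilon>) \<in> D \<and> det (J (t, x, \<epsilon>)) \<noteq> 0)" for V e
  define \<Omega> where "\<Omega> = (\<Union>(V, e)\<in>{(V, e). tube V e}. (UNIV :: real set) \<times> V \<times> {-e<..<e})"
  have "open \<Omega>"
    unfolding \<Omega>_def by (intro open_UN) (auto simp: tube_def open_Times)
  have \<Omega>_iff: "(t, x, \<epsilon>) \<in> \<Omega> \<longleftrightarrow> (\<exists>V e. tube V e \<and> x \<in> V \<and> \<bar>\<epsilon>\<bar> < e)" for t x \<epsilon>
  proof -
    have "\<epsilon> \<in> {-e<..<e} \<longleftrightarrow> \<bar>\<epsilon>\<bar> < e" for e by auto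
    then show ?thesis unfolding \<Omega>_def by blast
  qed
  have \<Omega>_star: "(t', x, s * \<epsilon>) \<in> \<Omega>" if "(t, x, \<epsilon>) \<in> \<Omega>" "s \<in> {0..1}" for t t' x \<epsilon> s
  proof -
    have "\<bar>s * \<epsilon>\<bar> \<le> 1 * \<bar>\<epsilon>\<bar>"
      unfolding abs_mult using that(2) by (intro mult_right_mono) auto
    moreover from that(1) obtain V e where "tube V e" "x \<in> V" "\<bar>\<epsilon>\<bar> < e"
      unfolding \<Omega>_iff by blast
    ultimately show ?thesis
      unfolding \<Omega>_iff by (intro exI[of _ V] exI[of _ e]) auto
  qed
  have \<Omega>D: "fst (snd q) \<in> D" "U q \<in> D" "det (J q) \<noteq> 0" "snd (snd q) \<in> {-\<epsilon>0..\<epsilon>0}" if "q \<in> \<Omega>" for q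
  proof -
    obtain t x \<epsilon> where q: "q = (t, x, \<epsilon>)" by (metis prod.exhaust)
    with that obtain V e where "tube V e" "x \<in> V" "\<bar>\<epsilon>\<bar> < e"
      by (auto simp: \<Omega>_iff)
    then show "fst (snd q) \<in> D" "U q \<in> D" "det (J q) \<noteq> 0" "snd (snd q) \<in> {-\<epsilon>0..\<epsilon>0}"
      unfolding q tube_def by (auto simp: abs_less_iff)
  qed
  have "\<Omega> \<subseteq> A"
    using \<Omega>D(1) by (auto simp: A_def)

  define Jv where "Jv q = frechet_derivative U (at q) (0, v (fst (snd q)), 0)" for q
  have "smooth_on A (\<lambda>q. v (fst (snd q)))"
    by (rule smooth_on_compose[OF v]) (auto simp: A_def intro!: smooth_on_intros)
  then have Jv: "smooth_on A Jv"
    unfolding Jv_def[abs_def] by (intro smooth_on_frechet_derivative[OF \<open>open A\<close> U] smooth_on_intros)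
  have Jv_eq: "Jv (t, x, \<epsilon>) = J (t, x, \<epsilon>) *v v x" if "x \<in> D" for t x \<epsilon>
    using J_apply that by (simp add: Jv_def A_iff)

  define Rq where "Rq q = R (fst q) (U q) (snd (snd q))" for q
  have Rq: "smooth_on \<Omega> Rq"
  proof -
    have "smooth_on \<Omega> (\<lambda>q. (\<lambda>(t, x, \<epsilon>). R t x \<epsilon>) (fst q, U q, snd (snd q)))"
      by (rule smooth_on_compose[OF R], intro smooth_on_intros smooth_on_subset[OF U \<open>\<Omega> \<subseteq> A\<close>])
        (use \<Omega>D in auto)
    then show ?thesis by (simp add: Rq_def[abs_def])
  qed
  have Fq: "smooth_on \<Omega> (\<lambda>q. F i (fst q) (U q))" if "i \<in> {1..k}" for i
  proof -
    have "smooth_on \<Omega> (\<lambda>q. (\<lambda>(t, x). F i t x) (fst q, U q))"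
      by (rule smooth_on_compose[OF F[OF that]], intro smooth_on_intros smooth_on_subset[OF U \<open>\<Omega> \<subseteq> A\<close>])
        (use \<Omega>D in auto)
    then show ?thesis by simp
  qed
  define \<Phi> where "\<Phi> q = (\<Sum>i = 1..k. snd (snd q) ^ i *\<^sub>R F i (fst q) (U q)) +
    snd (snd q) ^ (k + 1) *\<^sub>R Rq q - dU q - snd (snd q) ^ l *\<^sub>R Jv q" for q
  have \<Phi>_eq: "\<Phi> (t, x, \<epsilon>) = X t (near_identity k u t x \<epsilon>) \<epsilon> - dU (t, x, \<epsilon>) - \<epsilon> ^ l *\<^sub>R Jv (t, x, \<epsilon>)" for t x \<epsilon>
    by (simp add: \<Phi>_def X_def Rq_def U_eq)
  have \<Phi>: "smooth_on \<Omega> \<Phi>"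
    unfolding \<Phi>_def[abs_def]
    by (intro smooth_on_intros Fq Rq smooth_on_subset[OF dU \<open>\<Omega> \<subseteq> A\<close>] smooth_on_subset[OF Jv \<open>\<Omega> \<subseteq> A\<close>])
  have van: "vanishes_to_order (Suc l) (\<lambda>\<epsilon>. \<Phi> (t, x, \<epsilon>))" if q: "(t, x, 0) \<in> \<Omega>" for t x
  proof -
    have x: "x \<in> D" using \<Omega>D(1)[OF q] by simp
    have "isCont (\<lambda>\<epsilon>. Rq (t, x, \<epsilon>)) 0"
      by (rule isCont_o2[where g = Rq])
        (use smooth_on_imp_continuous_on[OF Rq] \<open>open \<Omega>\<close> q in
          \<open>auto simp: continuous_on_eq_continuous_at intro!: continuous_intros\<close>)
    then have 1: "vanishes_to_order (Suc l) (\<lambda>\<epsilon>. \<epsilon> ^ (k + 1) *\<^sub>R Rq (t, x, \<epsilon>))"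
      by (rule vanishes_to_order_power) (use \<open>l \<le> k\<close> in simp)
    have "(t, x, 0) \<in> A" using x by (simp add: A_iff)
    from taylor_expansion[OF \<open>open A\<close> this Jv, of 1 "(0, 0, 1)"] Jv_eq[OF x, of t 0] J0[OF x]
    have "vanishes_to_order 1 (\<lambda>\<epsilon>. Jv (t, x, \<epsilon>) - v x)"
      by simp
    from vanishes_to_order_shift[OF this, of l]
    have "vanishes_to_order (Suc l) (\<lambda>\<epsilon>. \<epsilon> ^ l *\<^sub>R (Jv (t, x, \<epsilon>) - v x))" by simp
    from vanishes_to_order_diff[OF vanishes_to_order_add[OF homological[OF x, of t] 1] this]
    show ?thesis
      by (simp add: \<Phi>_def dU_def U_eq algebra_simps)
  qed
  obtain H where H: "smooth_on \<Omega> H"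
    and \<Phi>_H: "\<And>t x \<epsilon>. (t, x, \<epsilon>) \<in> \<Omega> \<Longrightarrow> \<Phi> (t, x, \<epsilon>) = \<epsilon> ^ Suc l *\<^sub>R H (t, x, \<epsilon>)"
    using smooth_division[OF \<open>open \<Omega>\<close> \<Phi>, of "Suc l"] \<Omega>_star van by (metis zero_less_Suc)

  have \<Phi>_per: "\<Phi> (t + T, x, \<epsilon>) = \<Phi> (t, x, \<epsilon>)" if q: "(t, x, \<epsilon>) \<in> \<Omega>" for t x \<epsilon>
  proof -
    have x: "x \<in> D" "U (t, x, \<epsilon>) \<in> D" "\<epsilon> \<in> {-\<epsilon>0..\<epsilon>0}" using \<Omega>D[OF q] by simp_all
    show ?thesis
      using F_per[OF _ x(2)] R_per[OF x(2,3)] du_per[OF _ x(1)]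
      by (simp add: \<Phi>_def Rq_def dU_def Jv_eq[OF x(1)] U_per[OF x(1)] J_per[OF x(1)])
  qed
  \<comment> \<open>For \<open>\<epsilon> \<noteq> 0\<close> periodicity of \<open>H\<close> follows from that of \<open>\<Phi>\<close> by division, and at \<open>\<epsilon> = 0\<close> by
    continuity.\<close>
  have H_cont: "isCont (\<lambda>\<epsilon>. H (t, x, \<epsilon>)) 0" if "(t, x, 0) \<in> \<Omega>" for t x
    by (rule isCont_o2[where g = H])
      (use smooth_on_imp_continuous_on[OF H] \<open>open \<Omega>\<close> that in
        \<open>auto simp: continuous_on_eq_continuous_at intro!: continuous_intros\<close>)
  have H_per: "H (t + T, x, \<epsilon>) = H (t, x, \<epsilon>)" if q: "(t, x, \<epsilon>) \<in> \<Omega>" for t x \<epsilon>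
  proof -
    have off: "H (t + T, x, \<delta>) = H (t, x, \<delta>)" if "\<delta> \<noteq> 0" "(t, x, \<delta>) \<in> \<Omega>" for \<delta>
    proof -
      have "(t + T, x, \<delta>) \<in> \<Omega>" using that(2) by (simp add: \<Omega>_iff)
      then have "\<delta> ^ Suc l *\<^sub>R H (t + T, x, \<delta>) = \<delta> ^ Suc l *\<^sub>R H (t, x, \<delta>)"
        using \<Phi>_H \<Phi>_per[OF that(2)] that(2) by metis
      then show ?thesis using that(1) by simp
    qed
    have q0: "(t, x, 0) \<in> \<Omega>" "(t + T, x, 0) \<in> \<Omega>"
      using \<Omega>_star[OF q, of 0] by simp_all
    have "isCont (\<lambda>\<delta>. (t, x, \<delta>)) 0" by (intro continuous_intros)
    from eventually_nhds_isCont[OF this \<open>open \<Omega>\<close> q0(1)]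
    have "\<forall>\<^sub>F \<delta> in at 0. H (t + T, x, \<delta>) = H (t, x, \<delta>)"
      unfolding eventually_at_filter by eventually_elim (use off in blast)
    from tendsto_cong[OF this] H_cont[OF q0(1)] H_cont[OF q0(2)]
    have "H (t + T, x, 0) = H (t, x, 0)"
      unfolding isCont_def using LIM_unique by blast
    with off q show ?thesis by (cases "\<epsilon> = 0") auto
  qed

  define r where "r t x \<epsilon> = cramer_solution (J (t, x, \<epsilon>)) (H (t, x, \<epsilon>))" for t x \<epsilon>
  have "smooth_on \<Omega> (\<lambda>q. cramer_solution (J q) (H q))"
    by (rule smooth_on_cramer_solution[OF smooth_on_subset[OF J_entry \<open>\<Omega> \<subseteq> A\<close>] H \<Omega>D(3)])
  then have r: "smooth_on \<Omega> (\<lambda>(t, x, \<epsilon>). r t x \<epsilon>)"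
    by (simp add: r_def case_prod_unfold)
  have transforms: "transforms_at (near_identity k u) X
      (\<lambda>t \<xi> \<epsilon>. \<epsilon> ^ l *\<^sub>R v \<xi> + \<epsilon> ^ (l + 1) *\<^sub>R r t \<xi> \<epsilon>) t x \<epsilon>" if q: "(t, x, \<epsilon>) \<in> \<Omega>" for t x \<epsilon>
  proof -
    have x: "x \<in> D" "det (J (t, x, \<epsilon>)) \<noteq> 0" using \<Omega>D[OF q] by simp_all
    have "((\<lambda>s. \<epsilon> ^ i *\<^sub>R u i s x) has_vector_derivative \<epsilon> ^ i *\<^sub>R du i t x) (at t)" if "i \<in> {1..k}" for i
      using bounded_linear.has_vector_derivative[OF bounded_linear_scaleR_right u_du[OF that x(1)]] .
    then have "((\<lambda>s. \<Sum>i = 1..k. \<epsilon> ^ i *\<^sub>R u i s x) has_vector_derivative dU (t, x, \<epsilon>)) (at t)"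
      unfolding dU_def by (auto intro!: has_vector_derivative_sum)
    from has_vector_derivative_add[OF has_vector_derivative_const this, of x]
    have time: "vector_derivative (\<lambda>s. near_identity k u s x \<epsilon>) (at t) = dU (t, x, \<epsilon>)"
      unfolding near_identity_def by (intro vector_derivative_at) simp
    have space: "frechet_derivative (\<lambda>x. near_identity k u t x \<epsilon>) (at x) = (\<lambda>h. J (t, x, \<epsilon>) *v h)"
      using frechet_derivative_at[OF U_space[OF x(1)]] by metis
    have "J (t, x, \<epsilon>) *v (\<epsilon> ^ l *\<^sub>R v x + \<epsilon> ^ (l + 1) *\<^sub>R r t x \<epsilon>) =
        \<epsilon> ^ l *\<^sub>R Jv (t, x, \<epsilon>) + \<epsilon> ^ (l + 1) *\<^sub>R H (t, x, \<epsilon>)"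
      by (simp add: matrix_vector_right_distrib matrix_vector_mult_scaleR Jv_eq[OF x(1)] r_def
          cramer_solution[OF x(2)])
    then show ?thesis
      unfolding transforms_at_def time space using \<Phi>_H[OF q] \<Phi>_eq[of t x \<epsilon>] by (simp add: diff_eq_eq add_ac)
  qed

  show ?thesis
  proof (intro exI[of _ r] allI impI)
    fix V assume V: "open V \<and> compact (closure V) \<and> closure V \<subseteq> D"
    define B where "B = (A \<inter> U -` D) \<inter> (A \<inter> (\<lambda>q. det (J q)) -` (- {0}))"
    have "open B"
      unfolding B_def
      using smooth_on_imp_continuous_on[OF U] smooth_on_imp_continuous_on[OF smooth_on_det[OF J_entry]]
        \<open>open A\<close> \<open>open D\<close>
      by (intro open_Int continuous_open_preimage) auto
    have "(t, x, 0) \<in> B" if "x \<in> closure V" for t x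
      using that V det_J0[of x t] by (auto simp: B_def A_iff U0)
    moreover have "(t + T, x, \<epsilon>) \<in> B \<longleftrightarrow> (t, x, \<epsilon>) \<in> B" for t x \<epsilon>
      by (cases "x \<in> D") (simp_all add: B_def A_iff U_per J_per)
    ultimately obtain e where e: "e > 0" "\<And>t x \<epsilon>. x \<in> closure V \<Longrightarrow> \<bar>\<epsilon>\<bar> < e \<Longrightarrow> (t, x, \<epsilon>) \<in> B"
      using periodic_tube[OF \<open>open B\<close> _ \<open>T > 0\<close>, of "closure V"] V by metis
    have "tube V (min e \<epsilon>0)"
      unfolding tube_def using V e \<open>\<epsilon>0 > 0\<close> closure_subset[of V] by (auto simp: B_def)
    \<comment> \<open>Half the width of the tube leaves room for the closed interval \<open>[-\<epsilon>\<^sub>V, \<epsilon>\<^sub>V]\<close> in the open set \<open>\<Omega>\<close>.\<close>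
    define \<epsilon>V where "\<epsilon>V = min e \<epsilon>0 / 2"
    have \<epsilon>V: "0 < \<epsilon>V" "\<epsilon>V \<le> \<epsilon>0" "\<epsilon>V < min e \<epsilon>0"
      using e(1) \<open>\<epsilon>0 > 0\<close> by (auto simp: \<epsilon>V_def)
    have mem: "(t, x, \<epsilon>) \<in> \<Omega>" if "x \<in> V" "\<epsilon> \<in> {-\<epsilon>V..\<epsilon>V}" for t x \<epsilon>
      unfolding \<Omega>_iff using \<open>tube V (min e \<epsilon>0)\<close> that \<epsilon>V(3) by (intro exI conjI) auto
    have "near_identity k u t x \<epsilon> \<in> D \<and> r (t + T) x \<epsilon> = r t x \<epsilon> \<and>
        transforms_at (near_identity k u) X
          (\<lambda>t \<xi> \<epsilon>. \<epsilon> ^ l *\<^sub>R v \<xi> + \<epsilon> ^ (l + 1) *\<^sub>R r t \<xi> \<epsilon>) t x \<epsilon>"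
      if "x \<in> V" "\<epsilon> \<in> {-\<epsilon>V..\<epsilon>V}" for t x \<epsilon>
    proof -
      note q = mem[OF that, of t]
      show ?thesis
        using \<Omega>D(1,2)[OF q] transforms[OF q] H_per[OF q] J_per[of x t \<epsilon>] by (simp add: r_def U_eq)
    qed
    moreover have "smooth_on (UNIV \<times> V \<times> {-\<epsilon>V..\<epsilon>V}) (\<lambda>(t, \<xi>, \<epsilon>). r t \<xi> \<epsilon>)"
      by (rule smooth_on_subset[OF r]) (use mem in auto)
    ultimately show "\<exists>\<epsilon>V. 0 < \<epsilon>V \<and> \<epsilon>V \<le> \<epsilon>0 \<and>
        smooth_on (UNIV \<times> V \<times> {-\<epsilon>V..\<epsilon>V}) (\<lambda>(t, \<xi>, \<epsilon>). r t \<xi> \<epsilon>) \<and>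
        (\<forall>t. \<forall>\<xi>\<in>V. \<forall>\<epsilon>\<in>{-\<epsilon>V..\<epsilon>V}.
          near_identity k u t \<xi> \<epsilon> \<in> D \<and>
          r (t + T) \<xi> \<epsilon> = r t \<xi> \<epsilon> \<and>
          transforms_at (near_identity k u) X
            (\<lambda>t \<xi> \<epsilon>. \<epsilon> ^ l *\<^sub>R v \<xi> + \<epsilon> ^ (l + 1) *\<^sub>R r t \<xi> \<epsilon>) t \<xi> \<epsilon>)"
      using \<epsilon>V(1,2) by blast
  qed
qed

theorem corollary2:
  fixes D :: "(real ^ 'n) set"
    and F :: "nat \<Rightarrow> real \<Rightarrow> real ^ 'n \<Rightarrow> real ^ 'n"
    and R :: "real \<Rightarrow> real ^ 'n \<Rightarrow> real \<Rightarrow> real ^ 'n"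
    and T \<epsilon>0 :: real
    and k l :: nat
  assumes "k \<ge> 1" and "open D" and "T > 0" and "\<epsilon>0 > 0"
    and "\<And>i. i \<in> {1..k} \<Longrightarrow> smooth_on (UNIV \<times> D) (\<lambda>(t, x). F i t x)"
    and "\<And>i t x. i \<in> {1..k} \<Longrightarrow> x \<in> D \<Longrightarrow> F i (t + T) x = F i t x"
    and "smooth_on (UNIV \<times> D \<times> {-\<epsilon>0..\<epsilon>0}) (\<lambda>(t, x, \<epsilon>). R t x \<epsilon>)"
    and "\<And>t x \<epsilon>. x \<in> D \<Longrightarrow> \<epsilon> \<in> {-\<epsilon>0..\<epsilon>0} \<Longrightarrow> R (t + T) x \<epsilon> = R t x \<epsilon>"
    and "l \<in> {1..k}"
    and "\<And>i z. i < l \<Longrightarrow> z \<in> D \<Longrightarrow> melnikov F T i z = 0"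
  shows "\<exists>(u :: nat \<Rightarrow> real \<Rightarrow> real ^ 'n \<Rightarrow> real ^ 'n) (r :: real \<Rightarrow> real ^ 'n \<Rightarrow> real \<Rightarrow> real ^ 'n).
    (\<forall>i\<in>{1..k}. smooth_on (UNIV \<times> D) (\<lambda>(t, x). u i t x) \<and>
       (\<forall>t. \<forall>x\<in>D. u i (t + T) x = u i t x)) \<and>
    (\<forall>\<xi>\<in>D. \<forall>\<epsilon>. near_identity k u 0 \<xi> \<epsilon> = \<xi>) \<and>
    (\<forall>V. open V \<and> compact (closure V) \<and> closure V \<subseteq> D \<longrightarrow>
      (\<exists>\<epsilon>V. 0 < \<epsilon>V \<and> \<epsilon>V \<le> \<epsilon>0 \<and>
        smooth_on (UNIV \<times> V \<times> {-\<epsilon>V..\<epsilon>V}) (\<lambda>(t, \<xi>, \<epsilon>). r t \<xi> \<epsilon>) \<and>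
        (\<forall>t. \<forall>\<xi>\<in>V. \<forall>\<epsilon>\<in>{-\<epsilon>V..\<epsilon>V}.
          near_identity k u t \<xi> \<epsilon> \<in> D \<and>
          r (t + T) \<xi> \<epsilon> = r t \<xi> \<epsilon> \<and>
          transforms_at (near_identity k u)
            (\<lambda>t x \<epsilon>. (\<Sum>i = 1..k. \<epsilon> ^ i *\<^sub>R F i t x) + \<epsilon> ^ (k + 1) *\<^sub>R R t x \<epsilon>)
            (\<lambda>t \<xi> \<epsilon>. \<epsilon> ^ l *\<^sub>R ((1 / T) *\<^sub>R melnikov F T l \<xi>) + \<epsilon> ^ (l + 1) *\<^sub>R r t \<xi> \<epsilon>)
            t \<xi> \<epsilon>)))"
proof -
  note D = \<open>open D\<close> and l = \<open>l \<in> {1..k}\<close>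
  define f where "f x = (1 / T) *\<^sub>R melnikov F T l x" for x
  \<comment> \<open>For \<open>i = l\<close>, subtracting \<open>t f\<close> removes the growth \<open>T f\<close> of \<open>y\<^sub>l / l!\<close> over each period.\<close>
  define u where "u i t x = (if i \<le> l then (1 / fact i) *\<^sub>R melnikov_y F i t x else 0) -
    (if i = l then t *\<^sub>R f x else 0)" for i t x
  define du where "du i t x = (if i \<le> l then (1 / fact i) *\<^sub>R melnikov_rate F i t x else 0) -
    (if i = l then f x else 0)" for i t x

  have y: "smooth_on (UNIV \<times> D) (\<lambda>p. melnikov_y F i (fst p) (snd p))"
    and rate: "smooth_on (UNIV \<times> D) (\<lambda>p. melnikov_rate F i (fst p) (snd p))" if "i \<in> {1..k}" for i
    using smooth_on_melnikov_y[of D k F i] smooth_on_melnikov_rate[of D k F i] assms(5) D that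
    by (simp_all add: case_prod_unfold)
  have f: "smooth_on D f"
  proof -
    have "smooth_on D (\<lambda>x. (\<lambda>p. melnikov_y F l (fst p) (snd p)) (T, x))"
      by (rule smooth_on_compose[OF y[OF l]]) (auto intro!: smooth_on_intros)
    then have "smooth_on D (\<lambda>x. (1 / T) *\<^sub>R (1 / fact l) *\<^sub>R melnikov_y F l T x)"
      by (intro smooth_on_scaleR smooth_on_const) simp
    moreover have "f = (\<lambda>x. (1 / T) *\<^sub>R (1 / fact l) *\<^sub>R melnikov_y F l T x)"
      using l by (auto simp: f_def melnikov_def fun_eq_iff)
    ultimately show ?thesis by simp
  qed
  then have f': "smooth_on (UNIV \<times> D) (\<lambda>p. f (snd p))"
    by (rule smooth_on_compose) (auto intro!: smooth_on_intros)
  have u: "smooth_on (UNIV \<times> D) (\<lambda>(t, x). u i t x)" if "i \<in> {1..k}" for i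
  proof -
    have "smooth_on (UNIV \<times> D) (\<lambda>p. (if i \<le> l then 1 / fact i else 0) *\<^sub>R melnikov_y F i (fst p) (snd p) -
        ((if i = l then 1 else 0) * fst p) *\<^sub>R f (snd p))"
      by (intro smooth_on_intros y[OF that] f')
    moreover have "(\<lambda>(t, x). u i t x) = (\<lambda>p. (if i \<le> l then 1 / fact i else 0) *\<^sub>R melnikov_y F i (fst p) (snd p) -
        ((if i = l then 1 else 0) * fst p) *\<^sub>R f (snd p))"
      by (auto simp: u_def)
    ultimately show ?thesis by simp
  qed
  have du: "smooth_on (UNIV \<times> D) (\<lambda>(t, x). du i t x)" if "i \<in> {1..k}" for i
  proof -
    have "smooth_on (UNIV \<times> D) (\<lambda>p. (if i \<le> l then 1 / fact i else 0) *\<^sub>R melnikov_rate F i (fst p) (snd p) -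
        (if i = l then 1 else 0) *\<^sub>R f (snd p))"
      by (intro smooth_on_intros rate[OF that] f')
    moreover have "(\<lambda>(t, x). du i t x) = (\<lambda>p. (if i \<le> l then 1 / fact i else 0) *\<^sub>R melnikov_rate F i (fst p) (snd p) -
        (if i = l then 1 else 0) *\<^sub>R f (snd p))"
      by (auto simp: du_def)
    ultimately show ?thesis by simp
  qed
  have u_du: "((\<lambda>t. u i t x) has_vector_derivative du i t x) (at t)" if "i \<in> {1..k}" "x \<in> D" for i t x
  proof -
    have dy: "((\<lambda>t. melnikov_y F i t x) has_vector_derivative melnikov_rate F i t x) (at t)"
      using melnikov_y_has_vector_derivative[of D k F i x t] assms(5) D that by blast
    have "((\<lambda>t. (if i \<le> l then 1 / fact i else 0) *\<^sub>R melnikov_y F i t x - t *\<^sub>R (if i = l then f x else 0))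
        has_vector_derivative (if i \<le> l then 1 / fact i else 0) *\<^sub>R melnikov_rate F i t x - (if i = l then f x else 0)) (at t)"
      by (rule has_vector_derivative_diff[OF
          bounded_linear.has_vector_derivative[OF bounded_linear_scaleR_right dy]])
        (auto intro!: derivative_eq_intros)
    moreover have "(\<lambda>t. u i t x) = (\<lambda>t. (if i \<le> l then 1 / fact i else 0) *\<^sub>R melnikov_y F i t x - t *\<^sub>R (if i = l then f x else 0))"
      "du i t x = (if i \<le> l then 1 / fact i else 0) *\<^sub>R melnikov_rate F i t x - (if i = l then f x else 0)"
      by (auto simp: u_def du_def)
    ultimately show ?thesis by simp
  qed

  have y_per: "melnikov_y F i (t + T) x = melnikov_y F i t x" if "i \<in> {1..<l}" "x \<in> D" for i t x
    using melnikov_y_periodic[of D k F T l x i t] assms(5,6,10) D l that by simp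
  have rate_per: "melnikov_rate F i (t + T) x = melnikov_rate F i t x" if "i \<in> {1..l}" "x \<in> D" for i t x
    by (rule melnikov_rate_periodic[of D x k]) (use assms(6) D l that y_per in auto)
  have yl: "melnikov_y F l (t + T) x = melnikov_y F l t x + melnikov_y F l T x" if "x \<in> D" for t x
    using melnikov_y_add_period[of D k F l x T t] assms(5) D l rate_per that by simp
  have u_per: "u i (t + T) x = u i t x" if "i \<in> {1..k}" "x \<in> D" for i t x
  proof (cases i l rule: linorder_cases)
    case equal
    have "T *\<^sub>R f x = (1 / fact l) *\<^sub>R melnikov_y F l T x"
      using \<open>T > 0\<close> l by (simp add: f_def melnikov_def)
    then have "(t + T) *\<^sub>R f x = t *\<^sub>R f x + (1 / fact l) *\<^sub>R melnikov_y F l T x"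
      by (simp only: scaleR_add_left)
    with equal yl[OF that(2)] show ?thesis
      by (simp add: u_def scaleR_add_right)
  qed (use that y_per in \<open>simp_all add: u_def\<close>)
  have du_per: "du i (t + T) x = du i t x" if "i \<in> {1..k}" "x \<in> D" for i t x
    using that rate_per[of i x t] by (simp add: du_def)

  have homological: "vanishes_to_order (Suc l) (\<lambda>\<epsilon>.
      (\<Sum>i = 1..k. \<epsilon> ^ i *\<^sub>R F i t (near_identity k u t x \<epsilon>)) -
      (\<Sum>i = 1..k. \<epsilon> ^ i *\<^sub>R du i t x) - \<epsilon> ^ l *\<^sub>R f x)" if x: "x \<in> D" for t x
  proof -
    define w where "w m = fact m *\<^sub>R u m t x" for m
    have near: "near_identity k u t x \<epsilon> = x + (\<Sum>m = 1..k. (\<epsilon> ^ m / fact m) *\<^sub>R w m)" for \<epsilon>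
      by (simp add: near_identity_def w_def)
    have coeff: "(\<Sum>j<n. expansion_coeff (F (n - j) t) x w j) = (1 / fact n) *\<^sub>R melnikov_rate F n t x"
      if "n \<in> {1..l}" for n
    proof -
      \<comment> \<open>Coefficients with \<open>j < n \<le> l\<close> only involve vectors with index below \<open>l\<close>, for which \<open>w\<close> and
        \<open>y\<close> agree; the correction of \<open>y\<^sub>l\<close> is not seen at these orders.\<close>
      have "expansion_coeff (F (n - j) t) x w j =
          expansion_coeff (F (n - j) t) x (\<lambda>l. melnikov_y F l t x) j" if "j < n" for j
        by (rule expansion_coeff_cong_open[OF D x]) (use that \<open>n \<in> {1..l}\<close> in \<open>auto simp: w_def u_def\<close>)
      then show ?thesis by (simp add: melnikov_rate_def)
    qed
    have "(\<Sum>i = 1..k. \<epsilon> ^ i *\<^sub>R du i t x) + \<epsilon> ^ l *\<^sub>R f x =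
        (\<Sum>n = 1..l. \<epsilon> ^ n *\<^sub>R (\<Sum>j<n. expansion_coeff (F (n - j) t) x w j))" for \<epsilon>
    proof -
      have "(\<Sum>i = 1..k. \<epsilon> ^ i *\<^sub>R du i t x) =
          (\<Sum>i = 1..k. if i \<le> l then \<epsilon> ^ i *\<^sub>R (1 / fact i) *\<^sub>R melnikov_rate F i t x else 0) -
          (\<Sum>i = 1..k. if i = l then \<epsilon> ^ l *\<^sub>R f x else 0)"
        unfolding sum_subtractf[symmetric] by (rule sum.cong) (auto simp: du_def scaleR_diff_right)
      also have "(\<Sum>i = 1..k. if i = l then \<epsilon> ^ l *\<^sub>R f x else 0) = \<epsilon> ^ l *\<^sub>R f x"
        using l by simp
      also have "(\<Sum>i = 1..k. if i \<le> l then \<epsilon> ^ i *\<^sub>R (1 / fact i) *\<^sub>R melnikov_rate F i t x else 0) =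
          (\<Sum>i = 1..l. \<epsilon> ^ i *\<^sub>R (1 / fact i) *\<^sub>R melnikov_rate F i t x)"
        using l by (intro sum.mono_neutral_cong_right) auto
      also have "\<dots> = (\<Sum>n = 1..l. \<epsilon> ^ n *\<^sub>R (\<Sum>j<n. expansion_coeff (F (n - j) t) x w j))"
        by (rule sum.cong) (simp_all add: coeff)
      finally show ?thesis by simp
    qed
    moreover have "smooth_on D (F i t)" if "i \<in> {1..k}" for i
      using smooth_on_slice[OF assms(5)[OF that]] .
    note field_expansion[where f = "\<lambda>i. F i t" and w = w, OF D x this, of k l]
    ultimately show ?thesis
      unfolding near diff_diff_eq using l by simp
  qed

  have "near_identity k u 0 x \<epsilon> = x" for x \<epsilon>
  proof -
    have "u i 0 x = 0" if "i \<in> {1..k}" for i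
      using that by (simp add: u_def melnikov_y_0)
    then show ?thesis by (simp add: near_identity_def)
  qed
  moreover obtain r where "\<forall>V. open V \<and> compact (closure V) \<and> closure V \<subseteq> D \<longrightarrow>
      (\<exists>\<epsilon>V. 0 < \<epsilon>V \<and> \<epsilon>V \<le> \<epsilon>0 \<and>
        smooth_on (UNIV \<times> V \<times> {-\<epsilon>V..\<epsilon>V}) (\<lambda>(t, \<xi>, \<epsilon>). r t \<xi> \<epsilon>) \<and>
        (\<forall>t. \<forall>\<xi>\<in>V. \<forall>\<epsilon>\<in>{-\<epsilon>V..\<epsilon>V}.
          near_identity k u t \<xi> \<epsilon> \<in> D \<and>
          r (t + T) \<xi> \<epsilon> = r t \<xi> \<epsilon> \<and>
          transforms_at (near_identity k u)
            (\<lambda>t x \<epsilon>. (\<Sum>i = 1..k. \<epsilon> ^ i *\<^sub>R F i t x) + \<epsilon> ^ (k + 1) *\<^sub>R R t x \<epsilon>)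
            (\<lambda>t \<xi> \<epsilon>. \<epsilon> ^ l *\<^sub>R f \<xi> + \<epsilon> ^ (l + 1) *\<^sub>R r t \<xi> \<epsilon>)
            t \<xi> \<epsilon>))"
    using near_identity_normal_form[where F = F and u = u and du = du and R = R and v = f and l = l and k = k,
        OF D \<open>T > 0\<close> \<open>\<epsilon>0 > 0\<close> _ assms(5,6,7,8) u u_per du du_per u_du f homological] l
    by auto
  ultimately show ?thesis
    using u u_per unfolding f_def by (intro exI[of _ u] exI[of _ r]) blast
qed

end
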